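(* Let $\boldsymbol{W}$ be standard planar Brownian motion started at the origin, $\mathbb{D}$ the open unit disk in $\mathbb{R}^2$ and $\tau_{\mathbb{D}}=\inf\{t\ge0:\boldsymbol{W}_t\notin\mathbb{D}\}$. Let $\mathcal{H}^\star_{\tau_{\mathbb{D}}}$ be the star hull of the trace $\boldsymbol{W}_{[0,\tau_{\mathbb{D}}]}=\{\boldsymbol{W}_t:0\le t\le\tau_{\mathbb{D}}\}$. Then $$\mathbb{E}\big[\operatorname{Area}(\mathcal{H}^\star_{\tau_{\mathbb{D}}})\big]=\pi-\frac{8}{3}\approx 0.474925 .$$
   Context: The star hull of a set $\mathcal{A}\subset\mathbb{R}^2$ (with respect to the origin) is $\{\rho\boldsymbol{x}:0\le\rho\le1,\ \boldsymbol{x}\in\mathcal{A}\}$. $\operatorname{Area}$ denotes two-dimensional Lebesgue measure. *)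

theory Defs
  imports "HOL-Probability.Probability"
begin

definition gauss2_density :: "real \<Rightarrow> real \<times> real \<Rightarrow> ennreal" where
  "gauss2_density h z = ennreal (exp (- (norm z)\<^sup>2 / (2 * h)) / (2 * pi * h))"

definition planar_brownian_motion :: "'a measure \<Rightarrow> ('a \<Rightarrow> real \<Rightarrow> real \<times> real) \<Rightarrow> bool" where
  "planar_brownian_motion M W \<longleftrightarrow>
     prob_space M \<and>
     (\<forall>t\<ge>0. (\<lambda>\<omega>. W \<omega> t) \<in> borel_measurable M) \<and>
     (\<forall>\<omega>\<in>space M. W \<omega> 0 = 0 \<and> continuous_on {0..} (W \<omega>)) \<and>
     (\<forall>s t. 0 \<le> s \<and> s < t \<longrightarrow>
        distributed M lborel (\<lambda>\<omega>. W \<omega> t - W \<omega> s) (gauss2_density (t - s))) \<and>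
     (\<forall>(ts :: nat \<Rightarrow> real) n. 0 \<le> ts 0 \<and> (\<forall>i<n. ts i < ts (Suc i)) \<longrightarrow>
        prob_space.indep_vars M (\<lambda>_. borel) (\<lambda>i \<omega>. W \<omega> (ts (Suc i)) - W \<omega> (ts i)) {..<n})"

definition disk_exit_time :: "(real \<Rightarrow> real \<times> real) \<Rightarrow> real" where
  "disk_exit_time w = Inf {t. 0 \<le> t \<and> w t \<notin> ball 0 1}"

definition star_hull :: "(real \<times> real) set \<Rightarrow> (real \<times> real) set" where
  "star_hull A = {\<rho> *\<^sub>R x | \<rho> x. 0 \<le> \<rho> \<and> \<rho> \<le> 1 \<and> x \<in> A}"

end

theory Submission
  imports Defs "HOL-Complex_Analysis.Complex_Analysis"
begin

text \<open>
  A point \<open>x\<close> with \<open>0 < |x| = r < 1\<close> lies in the star hull iff the path meets the radial slit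
  \<open>[r, 1] x / r\<close> no later than its exit from the disk.  The probability of this event is the
  harmonic measure of the slit seen from \<open>0\<close>; the Cayley map followed by \<open>Arcsin\<close> straightens the
  slit disk to a strip and yields \<open>(2 / \<pi>) arcsin ((1 - r) / (1 + r))\<close>.  Integrating over the disk
  by Tonelli and the layer-cake formula turns the expected area into
  \<open>\<integral>\<^sub>0\<^sup>1 \<pi> tan\<^sup>4 (\<pi> / 4 - \<pi> s / 4) ds = \<pi> - 8 / 3\<close>.

  That a bounded harmonic function of the path stopped at the exit from a domain has the expected
  value given by its value at \<open>0\<close> needs no stochastic calculus.  Sample the path on a
  grid of mesh \<open>h\<close>, stopping at distance \<open>\<rho>\<close> from the complement of the domain.  Gaussian increments
  are rotation invariant, so by the mean value property one step changes the expectation only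
  through the event that the increment exceeds \<open>\<rho>\<close>, an error of order \<open>exp (- \<rho>\<^sup>2 / (4 h))\<close>; summed
  over \<open>t / h\<close> steps it vanishes as \<open>h \<rightarrow> 0\<close>.  Path continuity then allows \<open>h \<rightarrow> 0\<close>,
  \<open>\<rho> \<rightarrow> 0\<close> and \<open>t \<rightarrow> \<infinity>\<close>.
\<close>

section \<open>Rotation invariance and the mean value property\<close>

text \<open>Two obstacles shape the proof. Measurability is given only for the path at fixed times,
  and \<open>M\<close> need not be complete, so exit times, hitting events and the hull come with
  none. Hence expectations are taken of limits of functions of finitely many grid values, which
  agree with the intended quantities almost everywhere, and a jointly measurable graph described
  through rationals stands in for the hull when Tonelli is applied. The boundary values 1 on the
  slit and 0 on the circle clash at the point \<open>b\<close> where the two meet, and the harmonic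
  function has no limit there. So it has to be shown separately that the path almost surely does not
  leave the disk at \<open>b\<close>. The factor \<open>2 / pi\<close> normalises the real part of
  \<open>Arcsin\<close>, which tends to \<open>pi / 2\<close> at the image of the slit and vanishes
  on the imaginary axis, the image of the circle. The fourth power of \<open>tan\<close> is a
  squared radius: the points covered with probability above \<open>s\<close> form a punctured disk
  whose radius is a squared tangent.\<close>

definition cplx :: "real \<times> real \<Rightarrow> complex" where
  "cplx p = Complex (fst p) (snd p)"

lemma Re_cplx [simp]: "Re (cplx p) = fst p" and Im_cplx [simp]: "Im (cplx p) = snd p"
  by (simp_all add: cplx_def)

lemma cplx_0 [simp]: "cplx 0 = 0" and cplx_add: "cplx (p + q) = cplx p + cplx q"
  and cplx_scaleR: "cplx (c *\<^sub>R p) = of_real c * cplx p"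
  by (simp_all add: complex_eq_iff)

lemma norm_cplx [simp]: "cmod (cplx p) = norm p"
  by (cases p) (simp add: cplx_def norm_Pair complex_norm)

lemma inj_cplx: "cplx p = cplx q \<longleftrightarrow> p = q"
  by (simp add: complex_eq_iff prod_eq_iff)

lemma continuous_on_cplx [continuous_intros]:
  assumes "continuous_on S f" shows "continuous_on S (\<lambda>x. cplx (f x))"
proof -
  have eq: "(\<lambda>x. cplx (f x)) = (\<lambda>x. of_real (fst (f x)) + \<i> * of_real (snd (f x)))"
    by (auto simp: complex_eq_iff)
  show ?thesis unfolding eq using assms by (intro continuous_intros)
qed

lemma borel_measurable_cplx [measurable]: "cplx \<in> borel_measurable borel"
  by (intro borel_measurable_continuous_onI continuous_intros)

definition rot :: "real \<Rightarrow> real \<Rightarrow> real \<times> real \<Rightarrow> real \<times> real" where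
  "rot a b p = (a * fst p - b * snd p, b * fst p + a * snd p)"

lemma cplx_rot: "cplx (rot a b p) = Complex a b * cplx p"
  by (simp add: complex_eq_iff rot_def)

lemma norm_rot:
  assumes "a\<^sup>2 + b\<^sup>2 = 1" shows "norm (rot a b p) = norm p"
  using assms by (subst (1 2) norm_cplx[symmetric]) (simp add: cplx_rot norm_mult complex_norm)

lemma borel_measurable_rot [measurable]: "rot a b \<in> borel_measurable borel"
  unfolding rot_def by (intro borel_measurable_continuous_onI continuous_intros)

text \<open>With the sheared coordinate integrated first, the shear is for each fixed
  \<open>y\<close> a translation by \<open>c * y\<close>, which preserves
  \<open>lborel\<close>.\<close>

lemma nn_integral_shear_fst:
  fixes f :: "real \<times> real \<Rightarrow> ennreal"
  assumes [measurable]: "f \<in> borel_measurable borel"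
  shows "(\<integral>\<^sup>+p. f (fst p + c * snd p, snd p) \<partial>lborel) = (\<integral>\<^sup>+p. f p \<partial>lborel)"
proof -
  have "(\<integral>\<^sup>+p. f (fst p + c * snd p, snd p) \<partial>lborel) =
        (\<integral>\<^sup>+y. \<integral>\<^sup>+x. f (x + c * y, y) \<partial>lborel \<partial>lborel)"
    unfolding lborel_prod[symmetric]
    by (subst lborel_pair.nn_integral_snd[symmetric]) (auto simp: borel_prod[symmetric] simp del: borel_prod)
  also have "\<dots> = (\<integral>\<^sup>+y. \<integral>\<^sup>+x. f (x, y) \<partial>lborel \<partial>lborel)"
  proof (rule nn_integral_cong)
    fix y :: real
    show "(\<integral>\<^sup>+x. f (x + c * y, y) \<partial>lborel) = (\<integral>\<^sup>+x. f (x, y) \<partial>lborel)"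
      using nn_integral_real_affine[of "\<lambda>x. f (x, y)" 1 "c * y"] by (simp add: add.commute)
  qed
  also have "\<dots> = (\<integral>\<^sup>+p. f p \<partial>lborel)"
    unfolding lborel_prod[symmetric]
    by (subst lborel_pair.nn_integral_snd[symmetric]) (auto simp: lborel_prod)
  finally show ?thesis .
qed

lemma nn_integral_shear_snd:
  fixes f :: "real \<times> real \<Rightarrow> ennreal"
  assumes [measurable]: "f \<in> borel_measurable borel"
  shows "(\<integral>\<^sup>+p. f (fst p, snd p + c * fst p) \<partial>lborel) = (\<integral>\<^sup>+p. f p \<partial>lborel)"
proof -
  have "(\<integral>\<^sup>+p. f (fst p, snd p + c * fst p) \<partial>lborel) =
        (\<integral>\<^sup>+x. \<integral>\<^sup>+y. f (x, y + c * x) \<partial>lborel \<partial>lborel)"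
    unfolding lborel_prod[symmetric]
    by (subst lborel.nn_integral_fst[symmetric]) (auto simp: borel_prod[symmetric] simp del: borel_prod)
  also have "\<dots> = (\<integral>\<^sup>+x. \<integral>\<^sup>+y. f (x, y) \<partial>lborel \<partial>lborel)"
  proof (rule nn_integral_cong)
    fix x :: real
    show "(\<integral>\<^sup>+y. f (x, y + c * x) \<partial>lborel) = (\<integral>\<^sup>+y. f (x, y) \<partial>lborel)"
      using nn_integral_real_affine[of "\<lambda>y. f (x, y)" 1 "c * x"] by (simp add: add.commute)
  qed
  also have "\<dots> = (\<integral>\<^sup>+p. f p \<partial>lborel)"
    unfolding lborel_prod[symmetric]
    by (subst lborel.nn_integral_fst[symmetric]) (auto simp: lborel_prod)
  finally show ?thesis .
qed

text \<open>A rotation other than the half-turn is a product of three shears.\<close>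
lemma nn_integral_rot:
  fixes f :: "real \<times> real \<Rightarrow> ennreal"
  assumes [measurable]: "f \<in> borel_measurable borel" and ab: "a\<^sup>2 + b\<^sup>2 = 1"
  shows "(\<integral>\<^sup>+p. f (rot a b p) \<partial>lborel) = (\<integral>\<^sup>+p. f p \<partial>lborel)"
proof -
  have *: "(\<integral>\<^sup>+p. f (rot a b p) \<partial>lborel) = (\<integral>\<^sup>+p. f p \<partial>lborel)"
    if ab: "a\<^sup>2 + b\<^sup>2 = 1" "a \<noteq> -1" and [measurable]: "f \<in> borel_measurable borel"
    for a b and f :: "real \<times> real \<Rightarrow> ennreal"
  proof -
    \<comment> \<open>For \<open>a = cos \<theta>\<close> and \<open>b = sin \<theta>\<close> this
      is \<open>- tan (\<theta> / 2)\<close>, for which the shears by \<open>c\<close>,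
      \<open>b\<close>, \<open>c\<close> compose to the rotation. The pole at the half-turn is
      avoided below by writing that as two quarter-turns.\<close>
    define c where "c = - b / (1 + a)"
    have a1: "1 + a \<noteq> 0" using ab by linarith
    have e: "1 + c * b = a" "c + (1 + c * b) * c = - b"
    proof -
      have bb: "b * b = (1 - a) * (1 + a)" using ab by (simp add: power2_eq_square algebra_simps)
      have "c * b = - (b * b) / (1 + a)" by (simp add: c_def)
      also have "\<dots> = a - 1" unfolding bb using a1 by simp
      finally show 1: "1 + c * b = a" by simp
      have "c + (1 + c * b) * c = (1 + a) * c" unfolding 1 by (simp add: algebra_simps)
      also have "\<dots> = - b" unfolding c_def using a1 by simp
      finally show "c + (1 + c * b) * c = - b" .
    qed
    define s where "s = (\<lambda>p. (fst p + c * snd p, snd p) :: real \<times> real)"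
    define t where "t = (\<lambda>p. (fst p, snd p + b * fst p) :: real \<times> real)"
    have [measurable]: "s \<in> borel_measurable borel" "t \<in> borel_measurable borel"
      unfolding s_def t_def by (intro borel_measurable_continuous_onI continuous_intros)+
    have s_inv: "(\<integral>\<^sup>+p. g (s p) \<partial>lborel) = (\<integral>\<^sup>+p. g p \<partial>lborel)"
      if "g \<in> borel_measurable borel" for g :: "real \<times> real \<Rightarrow> ennreal"
      unfolding s_def using that by (rule nn_integral_shear_fst)
    have t_inv: "(\<integral>\<^sup>+p. g (t p) \<partial>lborel) = (\<integral>\<^sup>+p. g p \<partial>lborel)"
      if "g \<in> borel_measurable borel" for g :: "real \<times> real \<Rightarrow> ennreal"
      unfolding t_def using that by (rule nn_integral_shear_snd)
    have "s (t (s p)) = rot a b p" for p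
    proof -
      obtain x y where p: "p = (x, y)" by (cases p)
      have "x + c * y + c * (y + b * (x + c * y)) = (1 + c * b) * x + (c + (1 + c * b) * c) * y"
        by (simp add: algebra_simps)
      also have "\<dots> = a * x - b * y" unfolding e(2) unfolding e(1) by simp
      finally have 1: "x + c * y + c * (y + b * (x + c * y)) = a * x - b * y" .
      have "y + b * (x + c * y) = b * x + (1 + c * b) * y" by (simp add: algebra_simps)
      also have "\<dots> = b * x + a * y" unfolding e(1) by simp
      finally show ?thesis using 1 by (simp add: s_def t_def rot_def p)
    qed
    then have "(\<integral>\<^sup>+p. f (rot a b p) \<partial>lborel) = (\<integral>\<^sup>+p. (\<lambda>q. f (s (t q))) (s p) \<partial>lborel)" by simp
    also have "\<dots> = (\<integral>\<^sup>+p. (\<lambda>q. f (s q)) (t p) \<partial>lborel)"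
      by (rule s_inv) simp
    also have "\<dots> = (\<integral>\<^sup>+p. f (s p) \<partial>lborel)"
      by (rule t_inv) simp
    also have "\<dots> = (\<integral>\<^sup>+p. f p \<partial>lborel)"
      by (rule s_inv) simp
    finally show ?thesis .
  qed
  show ?thesis
  proof (cases "a = -1")
    case True
    then have b: "b = 0" using ab by simp
    have "rot a b p = rot 0 1 (rot 0 1 p)" for p by (simp add: rot_def True b)
    then show ?thesis using *[of 0 1 "\<lambda>p. f (rot 0 1 p)"] *[of 0 1 f] by simp
  next
    case False
    then show ?thesis using * ab assms by blast
  qed
qed

lemma holomorphic_circle_mean:
  assumes F: "F holomorphic_on ball z \<rho>" and v: "cmod v < \<rho>"
  shows "((\<lambda>t. F (z + cis (2 * pi * t) * v)) has_integral F z) {0..1}"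
proof (cases "v = 0")
  case True
  then show ?thesis using has_integral_const_real[of "F z" 0 1] by simp
next
  case False
  let ?r = "cmod v"
  have r: "?r > 0" using False by simp
  \<comment> \<open>\<open>circlepath\<close> starts in direction 1; turning by \<open>u\<close>
    about \<open>z\<close> makes the circle start at \<open>z + v\<close>.\<close>
  define u where "u = v / of_real ?r"
  have u: "cmod u = 1" "v = of_real ?r * u" using False by (auto simp: u_def norm_divide)
  define G where "G = (\<lambda>y. F (z + u * (y - z)))"
  have "G holomorphic_on cball z ?r"
  proof -
    have "(\<lambda>y. z + u * (y - z)) ` cball z ?r \<subseteq> ball z \<rho>"
      using v u by (auto simp: dist_norm norm_mult norm_minus_commute)
    then have "(F \<circ> (\<lambda>y. z + u * (y - z))) holomorphic_on cball z ?r"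
      by (intro holomorphic_on_compose_gen[OF _ F] holomorphic_intros)
    then show ?thesis by (simp add: G_def comp_def)
  qed
  then have "((\<lambda>y. G y / (y - z)) has_contour_integral (2 * of_real pi * \<i> * G z)) (circlepath z ?r)"
    using r by (intro Cauchy_integral_circlepath_simple) auto
  then have "((\<lambda>x. G (circlepath z ?r x) / (circlepath z ?r x - z) *
       vector_derivative (circlepath z ?r) (at x within {0..1})) has_integral 2 * of_real pi * \<i> * G z) {0..1}"
    by (simp add: has_contour_integral_def)
  then have "((\<lambda>x. (2 * of_real pi * \<i>) * F (z + cis (2 * pi * x) * v)) has_integral (2 * of_real pi * \<i>) * G z) {0..1}"
  proof (rule has_integral_eq_rhs[OF has_integral_eq, rotated])
    fix x :: real assume x: "x \<in> {0..1}"
    have e: "exp (2 * of_real pi * \<i> * of_real x) = cis (2 * pi * x)"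
      by (simp add: cis_conv_exp mult_ac)
    have "circlepath z ?r x - z = of_real ?r * cis (2 * pi * x)"
      unfolding circlepath by (simp add: e)
    moreover have "G (circlepath z ?r x) = F (z + cis (2 * pi * x) * v)"
    proof -
      have "u * (of_real ?r * cis (2 * pi * x)) = cis (2 * pi * x) * (of_real ?r * u)" by (simp only: mult_ac)
      also have "\<dots> = cis (2 * pi * x) * v" by (simp only: u(2)[symmetric])
      finally show ?thesis unfolding G_def circlepath e add_diff_cancel_left' by (simp only:)
    qed
    ultimately show "G (circlepath z ?r x) / (circlepath z ?r x - z) *
       vector_derivative (circlepath z ?r) (at x within {0..1}) = (2 * of_real pi * \<i>) * F (z + cis (2 * pi * x) * v)"
      using x r by (simp add: vector_derivative_circlepath01 e)
  qed simp
  then have "((\<lambda>x. F (z + cis (2 * pi * x) * v)) has_integral G z) {0..1}"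
    by (subst (asm) has_integral_mult_right_iff) auto
  then show ?thesis by (simp add: G_def)
qed

lemma borel_measurable_Re_holomorphic:
  assumes "F holomorphic_on S" "open S"
  shows "(\<lambda>z. indicator S z * Re (F z)) \<in> borel_measurable borel"
proof -
  have "(\<lambda>z. indicator S z *\<^sub>R Re (F z)) \<in> borel_measurable borel"
    using assms by (intro borel_measurable_continuous_on_indicator borel_open continuous_intros
        holomorphic_on_imp_continuous_on)
  then show ?thesis by simp
qed

text \<open>Rotating \<open>w\<close> by an independent uniform angle does not change its law
  \<open>\<nu>\<close>, while for fixed \<open>w\<close> the average over the angle is a circle
  mean, equal to \<open>Re (F z)\<close>. Fubini compares the two; \<open>U\<close> is the law of
  the angle as a fraction of a full turn.\<close>

lemma rot_invariant_mean_value: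
  fixes \<nu> :: "(real \<times> real) measure"
  assumes "prob_space \<nu>" and sets[measurable_cong]: "sets \<nu> = sets borel"
    and inv: "\<And>a b. a\<^sup>2 + b\<^sup>2 = 1 \<Longrightarrow> distr \<nu> borel (rot a b) = \<nu>"
    and F: "F holomorphic_on ball z \<rho>" and C: "\<And>y. y \<in> ball z \<rho> \<Longrightarrow> \<bar>Re (F y)\<bar> \<le> C" and rho: "\<rho> > 0"
  shows "(\<integral>w. indicator (ball 0 \<rho>) w * Re (F (z + cplx w)) \<partial>\<nu>) = Re (F z) * measure \<nu> (ball 0 \<rho>)"
proof -
  define U where "U = density lborel (\<lambda>x::real. ennreal (indicator {0..1} x))"
  interpret nu: prob_space \<nu> by fact
  interpret U: prob_space U
    by (rule prob_spaceI) (simp add: U_def emeasure_density ennreal_indicator)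
  interpret P: pair_prob_space \<nu> U ..
  have [measurable_cong]: "sets U = sets borel" by (simp add: U_def)
  define f where "f w = indicator (ball 0 \<rho>) w * Re (F (z + cplx w))" for w :: "real \<times> real"
  \<comment> \<open>The cut-off gives a Borel function bounded by \<open>C\<close> on the whole
    plane and depends on \<open>w\<close> only through its norm, so it commutes with rotating
    \<open>w\<close>.\<close>
  define f0 where "f0 y = indicator (ball z \<rho>) y * Re (F y)" for y
  have [measurable]: "f0 \<in> borel_measurable borel"
    unfolding f0_def using F by (intro borel_measurable_Re_holomorphic) auto
  have f_f0: "f w = f0 (z + cplx w)" for w
    by (auto simp: f_def f0_def indicator_def dist_norm)
  have [measurable]: "f \<in> borel_measurable borel" unfolding f_f0[abs_def] by measurable
  have C0: "C \<ge> 0" using C[of z] rho by auto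
  have f_bd: "\<bar>f w\<bar> \<le> C" for w
    using C[of "z + cplx w"] C0 by (auto simp: f_def indicator_def dist_norm)
  define g where "g w t = f0 (z + cis (2 * pi * t) * cplx w)" for w t
  have g_rot: "g w t = f (rot (cos (2 * pi * t)) (sin (2 * pi * t)) w)" for w t
    unfolding g_def f_f0 cplx_rot by (simp add: cis.code)
  have [measurable]: "cis \<in> borel_measurable borel"
    by (intro borel_measurable_continuous_onI continuous_intros)
  have [measurable]: "case_prod g \<in> borel_measurable (\<nu> \<Otimes>\<^sub>M U)"
    unfolding g_def by measurable
  have int: "integrable (\<nu> \<Otimes>\<^sub>M U) (case_prod g)"
    by (rule P.P.integrable_const_bound[where B=C]) (auto simp: g_rot f_bd)
  have 1: "(\<integral>w. g w t \<partial>\<nu>) = (\<integral>w. f w \<partial>\<nu>)" for t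
  proof -
    have "(\<integral>w. f w \<partial>\<nu>) = (\<integral>w. f w \<partial>distr \<nu> borel (rot (cos (2 * pi * t)) (sin (2 * pi * t))))"
      by (subst inv) auto
    also have "\<dots> = (\<integral>w. g w t \<partial>\<nu>)"
      unfolding g_rot by (rule integral_distr) auto
    finally show ?thesis by simp
  qed
  have 2: "(\<integral>t. g w t \<partial>U) = Re (F z) * indicator (ball 0 \<rho>) w" for w
  proof (cases "norm w < \<rho>")
    case False
    then have "g w t = 0" for t
      by (auto simp: g_def f0_def dist_norm norm_mult)
    then show ?thesis using False by simp
  next
    case True
    have gF: "g w t = Re (F (z + cis (2 * pi * t) * cplx w))" for t
      using True by (simp add: g_def f0_def dist_norm norm_mult)
    have "((\<lambda>t. F (z + cis (2 * pi * t) * cplx w)) has_integral F z) {0..1}"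
      using True F by (intro holomorphic_circle_mean) auto
    then have hi: "((\<lambda>t. g w t) has_integral Re (F z)) {0..1}"
      unfolding gF by (rule has_integral_Re)
    have [measurable]: "(\<lambda>t. g w t) \<in> borel_measurable borel" unfolding g_def by measurable
    have si: "set_integrable lborel {0..1} (\<lambda>t. g w t)"
      unfolding set_integrable_def
    proof (rule Bochner_Integration.integrable_bound)
      show "integrable lborel (\<lambda>x::real. C * indicator {0..1} x)" by simp
      have "\<bar>g w t\<bar> \<le> C" for t by (simp add: g_rot f_bd)
      then show "AE t in lborel. norm (indicator {0..1} t *\<^sub>R g w t) \<le> norm (C * indicator {0..1} t)"
        using C0 by (auto simp: indicator_def)
    qed measurable
    have "(\<integral>t. g w t \<partial>U) = (LINT t:{0..1}|lborel. g w t)"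
      unfolding U_def set_lebesgue_integral_def by (subst integral_density) auto
    also have "\<dots> = Re (F z)"
      using set_borel_integral_eq_integral(2)[OF si] hi by (simp add: integral_unique)
    finally show ?thesis using True by simp
  qed
  have "(\<integral>w. f w \<partial>\<nu>) = (\<integral>t. (\<integral>w. g w t \<partial>\<nu>) \<partial>U)"
    unfolding 1 by simp (simp add: U.prob_space)
  also have "\<dots> = (\<integral>w. (\<integral>t. g w t \<partial>U) \<partial>\<nu>)"
    using P.Fubini_integral[OF int] by simp
  also have "\<dots> = Re (F z) * measure \<nu> (ball 0 \<rho>)"
    unfolding 2 by (subst integral_mult_right_zero) (simp add: sets_eq_imp_space_eq[OF sets])
  finally show ?thesis by (simp add: f_def)
qed

section \<open>Gaussian increments\<close>

definition gauss :: "real \<Rightarrow> (real \<times> real) measure" where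
  "gauss h = density lborel (gauss2_density h)"

lemma borel_measurable_gauss2_density [measurable]: "gauss2_density h \<in> borel_measurable borel"
  unfolding gauss2_density_def by measurable

lemma sets_gauss [measurable_cong, simp]: "sets (gauss h) = sets borel"
  by (simp add: gauss_def)

lemma space_gauss [simp]: "space (gauss h) = UNIV"
  by (simp add: gauss_def)

lemma distr_gauss_rot:
  assumes "a\<^sup>2 + b\<^sup>2 = 1" shows "distr (gauss h) borel (rot a b) = gauss h"
proof (rule measure_eqI)
  fix A assume "A \<in> sets (distr (gauss h) borel (rot a b))"
  then have A[measurable]: "A \<in> sets borel" by simp
  have "emeasure (distr (gauss h) borel (rot a b)) A = emeasure (gauss h) (rot a b -` A)"
    by (subst emeasure_distr) auto
  also have "\<dots> = (\<integral>\<^sup>+p. gauss2_density h p * indicator (rot a b -` A) p \<partial>lborel)"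
    unfolding gauss_def using measurable_sets[OF borel_measurable_rot A]
    by (subst emeasure_density) auto
  also have "\<dots> = (\<integral>\<^sup>+p. (\<lambda>q. gauss2_density h q * indicator A q) (rot a b p) \<partial>lborel)"
    by (intro nn_integral_cong) (auto simp: gauss2_density_def norm_rot[OF assms] indicator_def)
  also have "\<dots> = (\<integral>\<^sup>+p. gauss2_density h p * indicator A p \<partial>lborel)"
    using assms by (intro nn_integral_rot) auto
  also have "\<dots> = emeasure (gauss h) A"
    unfolding gauss_def by (subst emeasure_density) auto
  finally show "emeasure (distr (gauss h) borel (rot a b)) A = emeasure (gauss h) A" .
qed simp

text \<open>Half of the exponent pays for the tail factor, the other half is the exponent of the
  density with parameter \<open>2 * h\<close>; the factor 2 is the ratio of the normalising
  constants. The tail is thus controlled by the total mass of another Gaussian law, without a radial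
  integral.\<close>

lemma gauss2_density_tail:
  assumes "h > 0" "\<rho> \<le> norm w" "\<rho> > 0"
  shows "gauss2_density h w \<le> ennreal (2 * exp (- \<rho>\<^sup>2 / (4 * h))) * gauss2_density (2 * h) w"
proof -
  have e: "- (norm w)\<^sup>2 / (2 * h) = - (norm w)\<^sup>2 / (4 * h) + - (norm w)\<^sup>2 / (2 * (2 * h))"
    by (simp add: field_simps)
  have "exp (- (norm w)\<^sup>2 / (4 * h)) \<le> exp (- \<rho>\<^sup>2 / (4 * h))"
    using assms by (simp add: divide_right_mono power_mono)
  then have "exp (- (norm w)\<^sup>2 / (2 * h)) \<le> exp (- \<rho>\<^sup>2 / (4 * h)) * exp (- (norm w)\<^sup>2 / (2 * (2 * h)))"
    unfolding e exp_add by (intro mult_right_mono) auto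
  then have "exp (- (norm w)\<^sup>2 / (2 * h)) / (2 * pi * h)
      \<le> (exp (- \<rho>\<^sup>2 / (4 * h)) * exp (- (norm w)\<^sup>2 / (2 * (2 * h)))) / (2 * pi * h)"
    using assms by (intro divide_right_mono) auto
  also have "\<dots> = 2 * exp (- \<rho>\<^sup>2 / (4 * h)) * (exp (- (norm w)\<^sup>2 / (2 * (2 * h))) / (2 * pi * (2 * h)))"
  proof -
    have "x * y / (2 * pi * h) = 2 * x * (y / (2 * pi * (2 * h)))" for x y :: real
      using assms by simp
    then show ?thesis .
  qed
  finally show ?thesis
    unfolding gauss2_density_def by (subst ennreal_mult'[symmetric]) (auto intro!: ennreal_leI)
qed

lemma measure_gauss_tail:
  assumes h: "h > 0" and rho: "\<rho> > 0" and "prob_space (gauss h)" "prob_space (gauss (2 * h))"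
  shows "measure (gauss h) (- ball 0 \<rho>) \<le> 2 * exp (- \<rho>\<^sup>2 / (4 * h))"
proof -
  interpret prob_space "gauss h" by fact
  interpret G2: prob_space "gauss (2 * h)" by fact
  have "emeasure (gauss h) (- ball 0 \<rho>) = (\<integral>\<^sup>+p. gauss2_density h p * indicator (- ball 0 \<rho>) p \<partial>lborel)"
    unfolding gauss_def by (subst emeasure_density) auto
  also have "\<dots> \<le> (\<integral>\<^sup>+p. ennreal (2 * exp (- \<rho>\<^sup>2 / (4 * h))) * gauss2_density (2 * h) p \<partial>lborel)"
    using gauss2_density_tail[OF h _ rho] by (intro nn_integral_mono) (simp add: indicator_def)
  also have "\<dots> = ennreal (2 * exp (- \<rho>\<^sup>2 / (4 * h))) * emeasure (gauss (2 * h)) UNIV"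
    unfolding gauss_def by (subst nn_integral_cmult) (auto simp: emeasure_density)
  also have "\<dots> = ennreal (2 * exp (- \<rho>\<^sup>2 / (4 * h)))"
    using G2.emeasure_space_1 by simp
  finally show ?thesis by (simp add: emeasure_eq_measure)
qed

text \<open>For increments shorter than \<open>\<rho>\<close> the mean value property makes the
  contribution zero. For longer ones the integrand is at most \<open>2 * C\<close>, and their
  probability is at most \<open>2 * exp (- \<rho>\<^sup>2 / (4 * h))\<close>.\<close>

lemma gauss_step_bound:
  assumes h: "h > 0" and rho: "\<rho> > 0" and "prob_space (gauss h)" "prob_space (gauss (2 * h))"
    and f[measurable]: "f \<in> borel_measurable borel" and C: "\<And>y. \<bar>f y\<bar> \<le> C"
    and F: "F holomorphic_on ball z \<rho>" and fF: "\<And>y. y \<in> ball z \<rho> \<Longrightarrow> f y = Re (F y)"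
  shows "\<bar>\<integral>w. f (z + cplx w) - f z \<partial>gauss h\<bar> \<le> 4 * C * exp (- \<rho>\<^sup>2 / (4 * h))"
proof -
  interpret prob_space "gauss h" by fact
  have C0: "C \<ge> 0" using C[of z] by linarith
  let ?b = "\<lambda>w. indicator (ball 0 \<rho>) w :: real" and ?c = "\<lambda>w. indicator (- ball 0 \<rho>) w :: real"
  have d: "\<bar>f (z + cplx w) - f z\<bar> \<le> 2 * C" for w using C[of "z + cplx w"] C[of z] by linarith
  have i1: "integrable (gauss h) (\<lambda>w. ?b w * f (z + cplx w))"
    using C C0 by (intro integrable_const_bound[where B=C]) (auto simp: indicator_def)
  have i2: "integrable (gauss h) (\<lambda>w. f z * ?b w)"
    using C C0 by (intro integrable_const_bound[where B=C]) (auto simp: indicator_def)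
  have i3: "integrable (gauss h) (\<lambda>w. ?c w * (f (z + cplx w) - f z))"
    using d C0 by (intro integrable_const_bound[where B="2 * C"]) (auto simp: indicator_def)
  have "(\<integral>w. ?b w * f (z + cplx w) \<partial>gauss h) = (\<integral>w. ?b w * Re (F (z + cplx w)) \<partial>gauss h)"
    by (intro Bochner_Integration.integral_cong) (auto simp: indicator_def fF dist_norm)
  also have "\<dots> = Re (F z) * measure (gauss h) (ball 0 \<rho>)"
    using assms C by (intro rot_invariant_mean_value[where C=C] distr_gauss_rot) (auto simp flip: fF)
  also have "\<dots> = (\<integral>w. f z * ?b w \<partial>gauss h)"
    using fF[of z] rho by simp
  finally have eq: "(\<integral>w. ?b w * f (z + cplx w) \<partial>gauss h) = (\<integral>w. f z * ?b w \<partial>gauss h)" .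
  have "(\<integral>w. f (z + cplx w) - f z \<partial>gauss h) =
        (\<integral>w. ((?b w * f (z + cplx w)) - (f z * ?b w)) + ?c w * (f (z + cplx w) - f z) \<partial>gauss h)"
    by (intro Bochner_Integration.integral_cong) (auto simp: indicator_def)
  also have "\<dots> = (\<integral>w. ?c w * (f (z + cplx w) - f z) \<partial>gauss h)"
    using i1 i2 i3 by (simp only: Bochner_Integration.integral_add Bochner_Integration.integral_diff
        Bochner_Integration.integrable_diff eq)
  finally have "\<bar>\<integral>w. f (z + cplx w) - f z \<partial>gauss h\<bar> \<le> (\<integral>w. \<bar>?c w * (f (z + cplx w) - f z)\<bar> \<partial>gauss h)"
    by (simp only: integral_abs_bound)
  also have "\<dots> \<le> (\<integral>w. 2 * C * ?c w \<partial>gauss h)"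
  proof (rule integral_mono)
    show "integrable (gauss h) (\<lambda>w. 2 * C * ?c w)"
      using C0 by (intro integrable_const_bound[where B="2 * C"]) (auto simp: indicator_def)
    show "\<bar>?c w * (f (z + cplx w) - f z)\<bar> \<le> 2 * C * ?c w" for w
      using d[of w] by (auto simp: indicator_def)
  qed (use i3 in auto)
  also have "\<dots> = 2 * C * measure (gauss h) (- ball 0 \<rho>)" by simp
  also have "\<dots> \<le> 2 * C * (2 * exp (- \<rho>\<^sup>2 / (4 * h)))"
    using assms C0 by (intro mult_left_mono measure_gauss_tail) auto
  finally show ?thesis by (simp add: mult_ac)
qed

section \<open>One step of the sampled Brownian path\<close>

locale planar_bm =
  fixes M :: "'a measure" and W :: "'a \<Rightarrow> real \<Rightarrow> real \<times> real"
  assumes bm: "planar_brownian_motion M W"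
begin

sublocale prob_space M
  using bm by (simp add: planar_brownian_motion_def)

definition Z :: "'a \<Rightarrow> real \<Rightarrow> complex" where "Z \<omega> t = cplx (W \<omega> t)"

lemma measurable_W: "t \<ge> 0 \<Longrightarrow> (\<lambda>\<omega>. W \<omega> t) \<in> borel_measurable M"
  using bm by (simp add: planar_brownian_motion_def)

lemma measurable_Z: "t \<ge> 0 \<Longrightarrow> (\<lambda>\<omega>. Z \<omega> t) \<in> borel_measurable M"
  unfolding Z_def using measurable_W by measurable

lemma W_0: "\<omega> \<in> space M \<Longrightarrow> W \<omega> 0 = 0"
  and continuous_W: "\<omega> \<in> space M \<Longrightarrow> continuous_on {0..} (W \<omega>)"
  using bm by (auto simp: planar_brownian_motion_def)

lemma Z_0: "\<omega> \<in> space M \<Longrightarrow> Z \<omega> 0 = 0"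
  and continuous_Z: "\<omega> \<in> space M \<Longrightarrow> continuous_on {0..} (Z \<omega>)"
  using W_0 continuous_W by (auto simp: Z_def[abs_def] intro!: continuous_intros)

lemma distr_increment:
  assumes "0 \<le> s" "s < t"
  shows "distr M borel (\<lambda>\<omega>. W \<omega> t - W \<omega> s) = gauss (t - s)"
proof -
  have "distributed M lborel (\<lambda>\<omega>. W \<omega> t - W \<omega> s) (gauss2_density (t - s))"
    using bm assms by (auto simp: planar_brownian_motion_def)
  then have "distr M lborel (\<lambda>\<omega>. W \<omega> t - W \<omega> s) = gauss (t - s)"
    by (simp add: distributed_def gauss_def)
  moreover have "distr M lborel (\<lambda>\<omega>. W \<omega> t - W \<omega> s) = distr M borel (\<lambda>\<omega>. W \<omega> t - W \<omega> s)"
    by (intro distr_cong) auto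
  ultimately show ?thesis by simp
qed

text \<open>No Gaussian integral is evaluated: the normalisation is inherited from the law of the
  increment over \<open>[0, h]\<close>.\<close>

lemma prob_space_gauss: assumes "h > 0" shows "prob_space (gauss h)"
proof -
  have "prob_space (distr M borel (\<lambda>\<omega>. W \<omega> h - W \<omega> 0))"
    using measurable_W[of h] measurable_W[of 0] assms by (intro prob_space_distr) auto
  then show ?thesis using distr_increment[of 0 h] assms by simp
qed

lemma indep_past_increment:
  assumes h: "h > 0"
  shows "indep_var (PiM {..<k} (\<lambda>_. borel)) (\<lambda>\<omega>. \<lambda>i\<in>{..<k}. W \<omega> (real (Suc i) * h) - W \<omega> (real i * h))
           (PiM {k} (\<lambda>_. borel)) (\<lambda>\<omega>. \<lambda>i\<in>{k}. W \<omega> (real (Suc i) * h) - W \<omega> (real i * h))"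
proof -
  define D where "D i \<omega> = W \<omega> (real (Suc i) * h) - W \<omega> (real i * h)" for i \<omega>
  have "indep_vars (\<lambda>_. borel) D {..<Suc k}"
    using bm h unfolding planar_brownian_motion_def D_def[abs_def]
    by (elim conjE allE[of _ "\<lambda>i. real i * h"] allE[of _ "Suc k"]) (auto simp: algebra_simps)
  then have "indep_var (PiM {..<k} (\<lambda>_. borel)) (\<lambda>\<omega>. restrict (\<lambda>i. D i \<omega>) {..<k})
      (PiM {k} (\<lambda>_. borel)) (\<lambda>\<omega>. restrict (\<lambda>i. D i \<omega>) {k})"
    by (rule indep_var_restrict) auto
  then show ?thesis by (simp add: D_def)
qed

lemma alive_step_bound:
  assumes h: "h > 0" and rho: "\<rho> > 0" and K: "K \<in> sets borel"
    and f[measurable]: "f \<in> borel_measurable borel" and C: "\<And>y. \<bar>f y\<bar> \<le> C"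
    and F: "\<And>z. z \<in> K \<Longrightarrow> F holomorphic_on ball z \<rho>"
    and fF: "\<And>y z. z \<in> K \<Longrightarrow> y \<in> ball z \<rho> \<Longrightarrow> f y = Re (F y)"
  shows "\<bar>\<integral>\<omega>. (if \<forall>i\<le>k. Z \<omega> (real i * h) \<in> K then f (Z \<omega> (real (Suc k) * h)) - f (Z \<omega> (real k * h)) else 0) \<partial>M\<bar>
           \<le> 4 * C * exp (- \<rho>\<^sup>2 / (4 * h))"
proof -
  note K[measurable]
  let ?P = "PiM {..<k} (\<lambda>_. borel :: (real \<times> real) measure)"
  define X where "X \<omega> = (\<lambda>i\<in>{..<k}. W \<omega> (real (Suc i) * h) - W \<omega> (real i * h))" for \<omega>
  let ?Q = "PiM {k} (\<lambda>_. borel :: (real \<times> real) measure)"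
  define Y where "Y \<omega> = (\<lambda>i\<in>{k}. W \<omega> (real (Suc i) * h) - W \<omega> (real i * h))" for \<omega>
  have C0: "C \<ge> 0" using C[of 0] by linarith
  have ind: "indep_var ?P X ?Q Y"
    unfolding X_def[abs_def] Y_def[abs_def] using indep_past_increment[OF h] .
  have X[measurable]: "X \<in> measurable M ?P" and Y[measurable]: "Y \<in> measurable M ?Q"
    and joint: "distr M ?P X \<Otimes>\<^sub>M distr M ?Q Y = distr M (?P \<Otimes>\<^sub>M ?Q) (\<lambda>\<omega>. (X \<omega>, Y \<omega>))"
    using ind unfolding indep_var_distribution_eq by auto
  have distrY: "distr M borel (\<lambda>\<omega>. Y \<omega> k) = gauss h"
    unfolding Y_def[abs_def] using h distr_increment[of "real k * h" "real (Suc k) * h"]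
    by (simp add: algebra_simps)
  \<comment> \<open>Independence concerns increments, so positions are rebuilt from them; the sum
    telescopes to the path because the path starts at 0.\<close>
  define pos where "pos i y = cplx (\<Sum>j<i. y j)" for i and y :: "nat \<Rightarrow> real \<times> real"
  have pos_meas: "pos i \<in> borel_measurable ?P" if "i \<le> k" for i
    unfolding pos_def using that by (intro measurable_compose[OF _ borel_measurable_cplx] borel_measurable_sum
        measurable_component_singleton) auto
  have pos_k[measurable]: "pos k \<in> borel_measurable ?P" by (rule pos_meas) simp
  have pos_X: "pos i (X \<omega>) = Z \<omega> (real i * h)" if "i \<le> k" "\<omega> \<in> space M" for i \<omega>
  proof -
    have "(\<Sum>j<i. X \<omega> j) = (\<Sum>j<i. W \<omega> (real (Suc j) * h) - W \<omega> (real j * h))"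
      using that by (intro sum.cong) (auto simp: X_def)
    also have "\<dots> = W \<omega> (real i * h)"
      using W_0[OF that(2)] by (subst sum_lessThan_telescope) simp
    finally show ?thesis by (simp add: pos_def Z_def)
  qed
  define G where "G y d = (if \<forall>i\<in>{..k}. pos i y \<in> K then f (pos k y + cplx (d k)) - f (pos k y) else 0)" for y d
  have [measurable]: "Measurable.pred ?P (\<lambda>y. \<forall>i\<in>{..k}. pos i y \<in> K)"
    by (intro pred_intros_finite pred_sets2[OF K pos_meas]) auto
  have G_meas[measurable]: "case_prod G \<in> borel_measurable (?P \<Otimes>\<^sub>M ?Q)"
    unfolding G_def by measurable
  interpret PX: prob_space "distr M ?P X" by (rule prob_space_distr) fact
  interpret PY: prob_space "distr M ?Q Y" by (rule prob_space_distr) fact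
  interpret PP: pair_prob_space "distr M ?P X" "distr M ?Q Y" ..
  have G_bd: "\<bar>G y d\<bar> \<le> 2 * C" for y d
    using C[of "pos k y + cplx (d k)"] C[of "pos k y"] by (auto simp: G_def intro: order_trans)
  have int: "integrable (distr M ?P X \<Otimes>\<^sub>M distr M ?Q Y) (case_prod G)"
    by (intro PP.P.integrable_const_bound[where B="2 * C"]) (auto simp: G_bd)
  have "(\<integral>\<omega>. (if \<forall>i\<le>k. Z \<omega> (real i * h) \<in> K then f (Z \<omega> (real (Suc k) * h)) - f (Z \<omega> (real k * h)) else 0) \<partial>M)
      = (\<integral>\<omega>. case_prod G (X \<omega>, Y \<omega>) \<partial>M)"
  proof (rule Bochner_Integration.integral_cong[OF refl])
    fix \<omega> assume w: "\<omega> \<in> space M"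
    have "Z \<omega> (real (Suc k) * h) = pos k (X \<omega>) + cplx (Y \<omega> k)"
      unfolding pos_X[OF order_refl w] by (simp add: Y_def Z_def flip: cplx_add)
    then show "(if \<forall>i\<le>k. Z \<omega> (real i * h) \<in> K then f (Z \<omega> (real (Suc k) * h)) - f (Z \<omega> (real k * h)) else 0)
      = case_prod G (X \<omega>, Y \<omega>)"
      using pos_X w by (auto simp: G_def)
  qed
  also have "\<dots> = (\<integral>p. case_prod G p \<partial>(distr M ?P X \<Otimes>\<^sub>M distr M ?Q Y))"
    unfolding joint by (subst integral_distr) auto
  also have "\<dots> = (\<integral>y. (\<integral>d. G y d \<partial>distr M ?Q Y) \<partial>distr M ?P X)"
    using PP.integral_fst[OF int] by simp
  also have "\<bar>\<dots>\<bar> \<le> (\<integral>y. \<bar>\<integral>d. G y d \<partial>distr M ?Q Y\<bar> \<partial>distr M ?P X)"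
    by (rule integral_abs_bound)
  also have "\<dots> \<le> (\<integral>y. 4 * C * exp (- \<rho>\<^sup>2 / (4 * h)) \<partial>distr M ?P X)"
  proof (rule integral_mono)
    show "integrable (distr M ?P X) (\<lambda>y. \<bar>\<integral>d. G y d \<partial>distr M ?Q Y\<bar>)"
      using PP.integrable_fst[OF int] by simp
    fix y
    show "\<bar>\<integral>d. G y d \<partial>distr M ?Q Y\<bar> \<le> 4 * C * exp (- \<rho>\<^sup>2 / (4 * h))"
    proof (cases "\<forall>i\<in>{..k}. pos i y \<in> K")
      case True
      then have "pos k y \<in> K" by auto
      then have "\<bar>\<integral>d. f (pos k y + cplx d) - f (pos k y) \<partial>gauss h\<bar> \<le> 4 * C * exp (- \<rho>\<^sup>2 / (4 * h))"
        using h rho C F fF by (intro gauss_step_bound[where F=F] prob_space_gauss) auto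
      moreover have "(\<integral>d. G y d \<partial>distr M ?Q Y) = (\<integral>\<omega>. f (pos k y + cplx (Y \<omega> k)) - f (pos k y) \<partial>M)"
        using True unfolding G_def by (subst integral_distr) auto
      moreover have "\<dots> = (\<integral>d. f (pos k y + cplx d) - f (pos k y) \<partial>gauss h)"
        unfolding distrY[symmetric] by (subst integral_distr) auto
      ultimately show ?thesis by simp
    next
      case False
      then have "G y d = 0" for d by (simp only: G_def if_False)
      then show ?thesis using C0 by simp
    qed
  qed auto
  also have "\<dots> = 4 * C * exp (- \<rho>\<^sup>2 / (4 * h))" using PX.prob_space by simp
  finally show ?thesis .
qed

end

section \<open>Stopping on a grid\<close>

text \<open>The first index at which \<open>A\<close> fails, capped at \<open>k\<close>. The
  recursion on the cap shows directly that one more step either moves the index from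
  \<open>k\<close> to \<open>Suc k\<close> or leaves it unchanged, which is what the induction over
  time steps uses.\<close>

primrec stop_idx :: "(nat \<Rightarrow> bool) \<Rightarrow> nat \<Rightarrow> nat" where
  "stop_idx A 0 = 0"
| "stop_idx A (Suc k) = (if \<forall>i\<le>k. A i then Suc k else stop_idx A k)"

lemma stop_idx_le: "stop_idx A k \<le> k"
  by (induction k) auto

lemma stop_idx_alive: "i < stop_idx A k \<Longrightarrow> A i"
  by (induction k) (auto split: if_splits)

lemma stop_idx_full: "\<forall>i<k. A i \<Longrightarrow> stop_idx A k = k"
  by (cases k) auto

lemma stop_idx_dead: "stop_idx A k < k \<Longrightarrow> \<not> A (stop_idx A k)"
proof (induction k)
  case (Suc k)
  show ?case
  proof (cases "\<forall>i\<le>k. A i")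
    case False
    then have eq: "stop_idx A (Suc k) = stop_idx A k" by (simp only: stop_idx.simps if_False)
    show ?thesis
    proof (cases "stop_idx A k < k")
      case True
      then show ?thesis using Suc.IH eq by simp
    next
      case False
      then have k: "stop_idx A k = k" using stop_idx_le[of A k] by simp
      then have "\<forall>i<k. A i" using stop_idx_alive[of _ A k] by simp
      then have "\<not> A k" using \<open>\<not> (\<forall>i\<le>k. A i)\<close> by (metis le_neq_implies_less)
      then show ?thesis using k eq by simp
    qed
  qed (use Suc in auto)
qed simp

section \<open>Exit of a continuous path from a closed set\<close>

context
  fixes z :: "real \<Rightarrow> complex" and K :: "complex set"
  assumes cont: "continuous_on {0..} z" and K: "closed K" and z0: "z 0 \<in> K"
    and ex: "\<exists>t\<ge>0. z t \<notin> K"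
begin

lemma exit_nearby:
  assumes "s \<ge> 0" "z s \<notin> K"
  obtains d where "d > 0" "\<And>y. y \<ge> 0 \<Longrightarrow> \<bar>y - s\<bar> < d \<Longrightarrow> z y \<notin> K"
proof -
  have "open (- K)" using K by auto
  then obtain e where e: "e > 0" "ball (z s) e \<subseteq> - K"
    using assms(2) by (metis ComplI openE)
  obtain d where "d > 0" "\<And>y. y \<in> {0..} \<Longrightarrow> dist y s < d \<Longrightarrow> dist (z y) (z s) < e"
    using cont assms(1) e(1) unfolding continuous_on_iff by (metis atLeast_iff)
  then show thesis using e(2) by (intro that[of d]) (auto simp: dist_real_def dist_commute subset_iff)
qed

text \<open>A path outside \<open>K\<close> at the infimum would, the complement being open, have
  been outside already slightly earlier. This places the stopped path inside \<open>K\<close>, where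
  the harmonic function will be continuous.\<close>

lemma exit_time_in_closed:
  assumes "t \<ge> 0"
  shows "z (min (Inf {t. 0 \<le> t \<and> z t \<notin> K}) t) \<in> K"
proof -
  let ?S = "{t. 0 \<le> t \<and> z t \<notin> K}"
  have bb: "bdd_below ?S" by (rule bdd_belowI[of _ 0]) auto
  have T0: "Inf ?S \<ge> 0" using ex by (intro cInf_greatest) auto
  have lt: "z s \<in> K" if "0 \<le> s" "s < Inf ?S" for s
    using cInf_lower[OF _ bb, of s] that by auto
  have "z (Inf ?S) \<in> K"
  proof (rule ccontr)
    assume n: "z (Inf ?S) \<notin> K"
    then have "Inf ?S > 0" using z0 T0 by (metis order_le_less)
    obtain d where d: "d > 0" "\<And>y. y \<ge> 0 \<Longrightarrow> \<bar>y - Inf ?S\<bar> < d \<Longrightarrow> z y \<notin> K"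
      using exit_nearby[OF T0 n] by blast
    define y where "y = max 0 (Inf ?S - d / 2)"
    have "y \<ge> 0" "y < Inf ?S" "\<bar>y - Inf ?S\<bar> < d" using d(1) \<open>Inf ?S > 0\<close> by (auto simp: y_def max_def)
    then show False using lt d(2) by blast
  qed
  then show ?thesis using lt[OF assms] by (auto simp: min_def not_le)
qed

text \<open>The grid cannot notice an exit before it happens, which bounds the limit from below. For
  the upper bound, arbitrarily soon after the exit time there is a whole time interval spent outside
  \<open>K\<close>, and a fine enough grid has a point in it.\<close>

lemma grid_exit_tendsto:
  assumes t: "t > 0"
  shows "(\<lambda>N. real (stop_idx (\<lambda>i. z (real i * (t / real N)) \<in> K) N) * (t / real N))
           \<longlonglongrightarrow> min (Inf {t. 0 \<le> t \<and> z t \<notin> K}) t"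
proof -
  let ?S = "{t. 0 \<le> t \<and> z t \<notin> K}"
  define T where "T = Inf ?S"
  define n where "n N = stop_idx (\<lambda>i. z (real i * (t / real N)) \<in> K) N" for N
  have bb: "bdd_below ?S" by (rule bdd_belowI[of _ 0]) auto
  have T0: "T \<ge> 0" unfolding T_def using ex by (intro cInf_greatest) auto
  have up: "real (n N) * (t / real N) \<le> t" if "N > 0" for N
  proof -
    have "real (n N) * t \<le> real N * t" using stop_idx_le t by (intro mult_right_mono) (auto simp: n_def)
    then show ?thesis using that by (simp add: field_simps)
  qed
  have low: "min T t \<le> real (n N) * (t / real N)" if "N > 0" for N
  proof (cases "n N < N")
    case True
    then have "z (real (n N) * (t / real N)) \<notin> K"
      using stop_idx_dead[of "\<lambda>i. z (real i * (t / real N)) \<in> K" N] by (simp add: n_def)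
    then have "T \<le> real (n N) * (t / real N)"
      unfolding T_def using t by (intro cInf_lower bb) auto
    then show ?thesis by simp
  next
    case False
    then have "n N = N" using stop_idx_le by (simp add: n_def antisym)
    then show ?thesis using that by simp
  qed
  have "(\<lambda>N. real (n N) * (t / real N)) \<longlonglongrightarrow> min T t"
  proof (rule order_tendstoI)
    fix a assume a: "a < min T t"
    show "\<forall>\<^sub>F N in sequentially. a < real (n N) * (t / real N)"
      by (rule eventually_mono[OF eventually_gt_at_top[of 0]]) (rule less_le_trans[OF a low])
  next
    fix a assume a: "min T t < a"
    show "\<forall>\<^sub>F N in sequentially. real (n N) * (t / real N) < a"
    proof (cases "t < a")
      case True
      then show ?thesis
        using up by (intro eventually_sequentiallyI[of 1]) (metis le_less_trans less_eq_Suc_le One_nat_def)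
    next
      case False
      then have "T < a" "a \<le> t" using a by auto
      then obtain s where s: "0 \<le> s" "z s \<notin> K" "s < a"
        using cInf_lessD[of ?S a] ex by (auto simp: T_def)
      obtain d where d: "d > 0" "\<And>y. y \<ge> 0 \<Longrightarrow> \<bar>y - s\<bar> < d \<Longrightarrow> z y \<notin> K"
        using exit_nearby[OF s(1,2)] by blast
      define e where "e = min d (a - s)"
      have "e > 0" using d s by (simp add: e_def)
      have "(\<lambda>N. t / real N) \<longlonglongrightarrow> 0" by (rule lim_const_over_n)
      then have "\<forall>\<^sub>F N in sequentially. t / real N < e"
        using \<open>e > 0\<close> by (rule order_tendstoD)
      then show ?thesis
      proof (eventually_elim, goal_cases)
        case (1 N)
        show ?case
        \<comment> \<open>Since \<open>t / real 0 = 0\<close>, the condition on the mesh does not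
          exclude \<open>N = 0\<close>.\<close>
        proof (cases "N = 0")
          case True
          then show ?thesis using T0 \<open>T < a\<close> by simp
        next
          case False
          define h where "h = t / real N"
          have h: "h > 0" "h < e" "real N * h = t" using False t 1 by (auto simp: h_def)
          \<comment> \<open>The first grid point at or after \<open>s\<close> overshoots by less
            than \<open>h < e\<close>; it is therefore still in the interval outside
            \<open>K\<close> around \<open>s\<close>, and before \<open>a\<close>.\<close>
          define i where "i = nat \<lceil>s / h\<rceil>"
          have "real i = of_int \<lceil>s / h\<rceil>" using s h by (simp add: i_def)
          then have "s / h \<le> real i" "real i < s / h + 1" by linarith+
          then have i: "s \<le> real i * h" "real i * h < s + h" using h by (auto simp: field_simps)
          have "z (real i * h) \<notin> K" using i h s by (intro d(2)) (auto simp: e_def)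
          then have "n N \<le> i"
            unfolding n_def h_def using stop_idx_alive[of i "\<lambda>i. z (real i * (t / real N)) \<in> K" N] by (meson not_le)
          then have "real (n N) * h \<le> real i * h" using h by (intro mult_right_mono) auto
          also have "\<dots> < a" using i h by (auto simp: e_def)
          finally show ?thesis by (simp add: h_def)
        qed
      qed
    qed
  qed
  then show ?thesis by (simp add: n_def T_def)
qed

end

section \<open>Stopped expectations, and leaving the disk\<close>

context planar_bm
begin

text \<open>The increments of the stopped value vanish once the path has been seen outside
  \<open>K\<close>, so each is exactly the integrand of \<open>alive_step_bound\<close>, and the
  errors add up over the \<open>k\<close> steps.\<close>

lemma stopped_expectation_bound:
  assumes h: "h > 0" and rho: "\<rho> > 0" and K: "K \<in> sets borel"
    and f[measurable]: "f \<in> borel_measurable borel" and C: "\<And>y. \<bar>f y\<bar> \<le> C"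
    and F: "\<And>z. z \<in> K \<Longrightarrow> F holomorphic_on ball z \<rho>"
    and fF: "\<And>y z. z \<in> K \<Longrightarrow> y \<in> ball z \<rho> \<Longrightarrow> f y = Re (F y)"
  defines "V \<equiv> \<lambda>k \<omega>. f (Z \<omega> (real (stop_idx (\<lambda>i. Z \<omega> (real i * h) \<in> K) k) * h))"
  shows "V k \<in> borel_measurable M" and "\<bar>(\<integral>\<omega>. V k \<omega> \<partial>M) - f 0\<bar> \<le> real k * (4 * C * exp (- \<rho>\<^sup>2 / (4 * h)))"
proof -
  have [measurable]: "(\<lambda>\<omega>. Z \<omega> (real i * h)) \<in> borel_measurable M" for i
    using h by (intro measurable_Z) auto
  note K[measurable]
  have VS: "V (Suc k) = (\<lambda>\<omega>. if \<forall>i\<in>{..k}. Z \<omega> (real i * h) \<in> K then f (Z \<omega> (real (Suc k) * h)) else V k \<omega>)" for k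
    by (auto simp: V_def fun_eq_iff)
  have V0: "V 0 \<omega> = f 0" if "\<omega> \<in> space M" for \<omega> using that Z_0 by (simp add: V_def)
  have [measurable]: "V k \<in> borel_measurable M" for k
  proof (induction k)
    case 0
    show ?case using V0 by (subst measurable_cong[where g="\<lambda>_. f 0"]) auto
  next
    case (Suc k)
    note Suc[measurable]
    show ?case unfolding VS by measurable
  qed
  then show "V k \<in> borel_measurable M" .
  have V_bd: "\<bar>V k \<omega>\<bar> \<le> C" for k \<omega> using C by (simp add: V_def)
  have V_int: "integrable M (V k)" for k
    by (intro integrable_const_bound[where B=C]) (simp_all add: V_bd)
  have diff: "V (Suc k) \<omega> - V k \<omega> = (if \<forall>i\<le>k. Z \<omega> (real i * h) \<in> K
      then f (Z \<omega> (real (Suc k) * h)) - f (Z \<omega> (real k * h)) else 0)" for k \<omega>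
    using stop_idx_full[of k "\<lambda>i. Z \<omega> (real i * h) \<in> K"] by (auto simp: V_def)
  show "\<bar>(\<integral>\<omega>. V k \<omega> \<partial>M) - f 0\<bar> \<le> real k * (4 * C * exp (- \<rho>\<^sup>2 / (4 * h)))"
  proof (induction k)
    case 0
    have "(\<integral>\<omega>. V 0 \<omega> \<partial>M) = (\<integral>\<omega>. f 0 \<partial>M)"
      using V0 by (intro Bochner_Integration.integral_cong) auto
    then show ?case by (simp add: prob_space)
  next
    case (Suc k)
    have "(\<integral>\<omega>. V (Suc k) \<omega> \<partial>M) - (\<integral>\<omega>. V k \<omega> \<partial>M) = (\<integral>\<omega>. V (Suc k) \<omega> - V k \<omega> \<partial>M)"
      using V_int by simp
    then have "\<bar>(\<integral>\<omega>. V (Suc k) \<omega> \<partial>M) - (\<integral>\<omega>. V k \<omega> \<partial>M)\<bar> \<le> 4 * C * exp (- \<rho>\<^sup>2 / (4 * h))"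
      unfolding diff using alive_step_bound[where k=k, OF h rho K f C F fF] by (simp only:)
    then show ?case using Suc by (simp add: algebra_simps)
  qed
qed

text \<open>At time \<open>t\<close> the density is at most \<open>1 / (2 * pi * t)\<close> and the
  disk has area \<open>pi\<close>, so the path is in the disk with probability at most
  \<open>1 / (2 * t)\<close>, which tends to 0 along the integers.\<close>

lemma AE_exits_disk: "AE \<omega> in M. \<exists>t\<ge>0. Z \<omega> t \<notin> ball 0 1"
proof -
  have [measurable]: "(\<lambda>\<omega>. Z \<omega> (real i)) \<in> borel_measurable M" for i
    by (intro measurable_Z) auto
  define E where "E = {\<omega>\<in>space M. \<forall>n::nat. Z \<omega> (real n) \<in> ball 0 1}"
  have [measurable]: "ball (0 :: complex) 1 \<in> sets borel" by simp
  have [measurable]: "E \<in> sets M" unfolding E_def by measurable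
  have "prob E \<le> 1 / (2 * real (Suc n))" for n
  proof -
    let ?t = "real (Suc n)"
    have W[measurable]: "(\<lambda>\<omega>. W \<omega> ?t) \<in> borel_measurable M" "(\<lambda>\<omega>. W \<omega> 0) \<in> borel_measurable M"
      by (auto intro!: measurable_W)
    have "emeasure M E \<le> emeasure M ((\<lambda>\<omega>. W \<omega> ?t - W \<omega> 0) -` ball 0 1 \<inter> space M)"
    proof (rule emeasure_mono)
      show "E \<subseteq> (\<lambda>\<omega>. W \<omega> ?t - W \<omega> 0) -` ball 0 1 \<inter> space M"
        using W_0 by (auto simp: E_def Z_def simp del: of_nat_Suc)
    qed measurable
    also have "\<dots> = emeasure (distr M borel (\<lambda>\<omega>. W \<omega> ?t - W \<omega> 0)) (ball 0 1)"
      by (subst emeasure_distr) (auto simp del: of_nat_Suc)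
    also have "\<dots> = emeasure (gauss ?t) (ball 0 1)" by (subst distr_increment) auto
    also have "\<dots> = (\<integral>\<^sup>+p. gauss2_density ?t p * indicator (ball 0 1) p \<partial>lborel)"
      unfolding gauss_def by (subst emeasure_density) auto
    also have "\<dots> \<le> (\<integral>\<^sup>+p. ennreal (1 / (2 * pi * ?t)) * indicator (ball 0 1 :: (real \<times> real) set) p \<partial>lborel)"
      unfolding gauss2_density_def
      by (intro nn_integral_mono mult_right_mono ennreal_leI divide_right_mono) (auto simp del: of_nat_Suc)
    also have "\<dots> = ennreal (1 / (2 * pi * ?t)) * ennreal pi"
      by (subst nn_integral_cmult_indicator) (auto simp: emeasure_ball unit_ball_vol_2)
    also have "\<dots> = ennreal (1 / (2 * ?t))"
      by (subst ennreal_mult[symmetric]) (auto simp del: of_nat_Suc)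
    finally show ?thesis by (simp add: emeasure_eq_measure del: of_nat_Suc)
  qed
  moreover have "(\<lambda>n. 1 / (2 * real (Suc n))) \<longlonglongrightarrow> 0"
    using LIMSEQ_inverse_real_of_nat[THEN tendsto_mult_right[of _ _ _ "1/2"]] by (simp add: field_simps)
  ultimately have "prob E \<le> 0" by (intro LIMSEQ_le_const) auto
  then have "emeasure M E = 0" by (simp add: emeasure_eq_measure measure_le_0_iff)
  then have "AE \<omega> in M. \<omega> \<notin> E" by (intro AE_not_in) (auto simp: null_sets_def)
  with AE_space show ?thesis
  proof eventually_elim
    case (elim \<omega>)
    then obtain n :: nat where "Z \<omega> (real n) \<notin> ball 0 1" by (auto simp: E_def)
    then show ?case by (intro exI[of _ "real n"]) simp
  qed
qed

end

section \<open>Harmonic functions at the exit time\<close>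

lemma infdist_ge_imp_ball_subset:
  fixes S :: "complex set"
  assumes "r \<le> infdist z (- S)" shows "ball z r \<subseteq> S"
proof (rule subsetI, rule ccontr)
  fix y assume y: "y \<in> ball z r" "y \<notin> S"
  then have "infdist z (- S) \<le> dist z y" by (intro infdist_le) auto
  then show False using y assms by simp
qed

lemma exponential_beats_linear:
  assumes "c > 0" shows "(\<lambda>N. real N * (b * exp (- (c * real N)))) \<longlonglongrightarrow> 0"
proof -
  have e: "exp (- c) < 1" "exp (- c) \<ge> 0" using assms by auto
  have "(\<lambda>N. real N * exp (- c) ^ N) \<longlonglongrightarrow> 0"
    using powser_times_n_limit_0[of "exp (- c)"] e by simp
  then have "(\<lambda>N. b * (real N * exp (- c) ^ N)) \<longlonglongrightarrow> b * 0" by (rule tendsto_mult_left)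
  then show ?thesis by (simp add: exp_of_nat_mult[symmetric] mult_ac)
qed

text \<open>For an open set, unlike a closed one, the infimum is attained: the path is already
  outside at \<open>T\<close>. Boundary values are therefore limits from the left of
  \<open>T\<close>.\<close>

lemma continuous_exit_value:
  fixes z :: "real \<Rightarrow> complex"
  assumes cont: "continuous_on {0..} z" and S: "open S" and z0: "z 0 \<in> S" and ex: "\<exists>t\<ge>0. z t \<notin> S"
  defines "T \<equiv> Inf {t. 0 \<le> t \<and> z t \<notin> S}"
  shows "T > 0" "z T \<notin> S" "\<And>t. 0 \<le> t \<Longrightarrow> t < T \<Longrightarrow> z t \<in> S" "\<And>t. 0 \<le> t \<Longrightarrow> z t \<notin> S \<Longrightarrow> T \<le> t"
    "(z \<longlongrightarrow> z T) (at_left T)"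
proof -
  let ?A = "{t. 0 \<le> t \<and> z t \<notin> S}"
  have bb: "bdd_below ?A" by (rule bdd_belowI[of _ 0]) auto
  have T0: "T \<ge> 0" unfolding T_def using ex by (intro cInf_greatest) auto
  show le: "T \<le> t" if "0 \<le> t" "z t \<notin> S" for t
    unfolding T_def using that by (intro cInf_lower bb) auto
  then show "z t \<in> S" if "0 \<le> t" "t < T" for t using that by force
  show nT: "z T \<notin> S"
  proof
    assume "z T \<in> S"
    obtain e where e: "e > 0" "ball (z T) e \<subseteq> S" using S \<open>z T \<in> S\<close> openE by blast
    obtain d where d: "d > 0" "\<And>y. y \<in> {0..} \<Longrightarrow> dist y T < d \<Longrightarrow> dist (z y) (z T) < e"
      using cont T0 e(1) unfolding continuous_on_iff by (metis atLeast_iff)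
    obtain t where t: "t \<in> ?A" "t < T + d" using cInf_lessD[of ?A "T + d"] ex d(1) by (auto simp: T_def)
    have "T \<le> t" using t le by auto
    then have "dist (z t) (z T) < e" using d(2)[of t] t by (auto simp: dist_real_def)
    then show False using e(2) t by (auto simp: dist_commute subset_iff)
  qed
  show T_pos: "T > 0" using T0 nT z0 by (metis order_le_less)
  have "continuous (at T within {0..}) z" using cont T0 by (simp add: continuous_on_eq_continuous_within)
  then have "(z \<longlongrightarrow> z T) (at T within {0..})" by (simp add: continuous_within)
  then have "(z \<longlongrightarrow> z T) (at T within {0..T})" by (rule tendsto_within_subset) auto
  then show "(z \<longlongrightarrow> z T) (at_left T)"
    using T_pos by (simp add: at_within_Icc_at_left)
qed

text \<open>Up to any \<open>b < T\<close> the path is a compact subset of \<open>S\<close>, so it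
  keeps a positive distance from the complement and stays in \<open>K n\<close> for large
  \<open>n\<close>. The approach to \<open>T\<close> is strictly from below because the path is in
  \<open>K n \<subseteq> S\<close> at the stopping time but outside \<open>S\<close> at
  \<open>T\<close>; the filter \<open>at_left\<close> requires this.\<close>

lemma exit_times_exhaust:
  fixes z :: "real \<Rightarrow> complex" and S :: "complex set"
  assumes cont: "continuous_on {0..} z" and S: "open S" and z0: "z 0 \<in> S" and ex: "\<exists>t\<ge>0. z t \<notin> S"
  defines "K \<equiv> \<lambda>n. {y. inverse (real (Suc n)) \<le> infdist y (- S)}"
  shows "filterlim (\<lambda>n. min (Inf {t. 0 \<le> t \<and> z t \<notin> K n}) (real (Suc n)))
           (at_left (Inf {t. 0 \<le> t \<and> z t \<notin> S})) sequentially"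
proof -
  let ?A = "{t. 0 \<le> t \<and> z t \<notin> S}"
  define T where "T = Inf ?A"
  define s where "s n = min (Inf {t. 0 \<le> t \<and> z t \<notin> K n}) (real (Suc n))" for n
  have bb: "bdd_below {t. 0 \<le> t \<and> z t \<notin> B}" for B by (rule bdd_belowI[of _ 0]) auto
  have K_S: "K n \<subseteq> S" for n
  proof
    fix y assume "y \<in> K n"
    then have "ball y (inverse (real (Suc n))) \<subseteq> S" unfolding K_def by (intro infdist_ge_imp_ball_subset) auto
    then show "y \<in> S" by (auto simp: subset_iff)
  qed
  have K_closed: "closed (K n)" for n
    unfolding K_def by (intro closed_Collect_le continuous_intros)
  have exK: "\<exists>t\<ge>0. z t \<notin> K n" for n using ex K_S by blast
  note E = continuous_exit_value[OF cont S z0 ex, folded T_def]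
  have exh: "\<forall>\<^sub>F n in sequentially. \<forall>t\<in>{0..b}. z t \<in> K n" if b: "b < T" for b
  proof -
    have comp: "compact (z ` {0..b})" by (intro compact_continuous_image continuous_on_subset[OF cont]) auto
    have disj: "z ` {0..b} \<inter> - S = {}" using E(3) b by auto
    from separate_compact_closed[OF comp closed_Compl[OF S] disj]
    obtain d where d: "d > 0" "\<forall>x\<in>z ` {0..b}. \<forall>y\<in>- S. d \<le> dist x y" by (elim exE conjE)
    have ne: "- S \<noteq> {}" using ex by auto
    have di: "d \<le> infdist (z t) (- S)" if "t \<in> {0..b}" for t
      unfolding infdist_notempty[OF ne] using d(2) that ne by (intro cINF_greatest) auto
    have "\<forall>\<^sub>F n in sequentially. inverse (real (Suc n)) < d"
      using LIMSEQ_inverse_real_of_nat d(1) by (rule order_tendstoD)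
    then show ?thesis by eventually_elim (use di in \<open>force simp: K_def\<close>)
  qed
  have "s \<longlonglongrightarrow> T"
  proof (rule order_tendstoI)
    fix a assume a: "a < T"
    define b where "b = (max a 0 + T) / 2"
    have b: "b < T" "a < b" using a E(1) by (auto simp: b_def max_def)
    have "\<forall>\<^sub>F n in sequentially. a < real (Suc n)"
      using filterlim_real_sequentially by (subst eventually_sequentially_Suc) (simp add: filterlim_at_top_dense)
    with exh[OF b(1)] show "\<forall>\<^sub>F n in sequentially. a < s n"
    proof eventually_elim
      case (elim n)
      have "b \<le> Inf {t. 0 \<le> t \<and> z t \<notin> K n}"
        using exK[of n] elim by (intro cInf_greatest) (auto simp: not_le[symmetric])
      then show ?case using elim b by (auto simp: s_def)
    qed
  next
    fix a assume a: "T < a"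
    have sT: "s n \<le> T" for n
    proof -
      have "Inf {t. 0 \<le> t \<and> z t \<notin> K n} \<le> T"
        using E(1) E(2) K_S by (intro cInf_lower bb) auto
      then show ?thesis by (simp add: s_def)
    qed
    show "\<forall>\<^sub>F n in sequentially. s n < a"
      by (intro always_eventually allI) (rule le_less_trans[OF sT a])
  qed
  moreover have "\<forall>\<^sub>F n in sequentially. s n < T"
    using exh[OF E(1)]
  proof eventually_elim
    case (elim n)
    then have z0: "z 0 \<in> K n" by auto
    have "z (s n) \<in> K n" unfolding s_def
      by (rule exit_time_in_closed[OF cont K_closed z0 exK]) simp
    then have "s n \<noteq> T" using K_S E(2) by auto
    moreover have "Inf {t. 0 \<le> t \<and> z t \<notin> K n} \<le> T"
      using E(1) E(2) K_S by (intro cInf_lower bb) auto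
    ultimately show ?case by (simp add: s_def)
  qed
  ultimately show ?thesis
    unfolding s_def[symmetric] T_def[symmetric] by (intro tendsto_imp_filterlim_at_left)
qed

context planar_bm
begin

text \<open>The boundary value \<open>g\<close> need not be measurable as \<open>M\<close> is not assumed complete; hence the version \<open>g'\<close>.\<close>
lemma harmonic_exit_value:
  assumes S: "open S" and S0: "0 \<in> S" and S1: "S \<subseteq> ball 0 1"
    and F: "F holomorphic_on S" and C: "\<And>z. z \<in> S \<Longrightarrow> \<bar>Re (F z)\<bar> \<le> C"
    and lim: "AE \<omega> in M. ((\<lambda>s. Re (F (Z \<omega> s))) \<longlongrightarrow> g \<omega>) (at_left (Inf {t. 0 \<le> t \<and> Z \<omega> t \<notin> S}))"
  obtains g' where "g' \<in> borel_measurable M" "AE \<omega> in M. g' \<omega> = g \<omega>" "(\<integral>\<omega>. g' \<omega> \<partial>M) = Re (F 0)"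
proof -
  \<comment> \<open>A Gaussian step may jump out of \<open>S\<close>, so the function is extended by
    0 to a bounded Borel function on the plane.\<close>
  define f where "f y = indicator S y * Re (F y)" for y
  have f_meas[measurable]: "f \<in> borel_measurable borel"
    unfolding f_def using F S by (rule borel_measurable_Re_holomorphic)
  have C0: "C \<ge> 0" using C[OF S0] by linarith
  have f_bd: "\<bar>f y\<bar> \<le> C" for y using C[of y] C0 by (auto simp: f_def indicator_def)
  have f_cont: "isCont f y" if "y \<in> S" for y
  proof -
    have "continuous_on S (\<lambda>y. Re (F y))"
      using F by (intro continuous_intros holomorphic_on_imp_continuous_on)
    then have "isCont (\<lambda>y. Re (F y)) y" using S that by (simp add: continuous_on_eq_continuous_at)
    moreover have "\<forall>\<^sub>F x in nhds y. Re (F x) = f x"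
      using eventually_nhds_in_open[OF S that] by eventually_elim (simp add: f_def)
    ultimately show ?thesis by (simp add: isCont_cong)
  qed
  \<comment> \<open>A ball of radius \<open>inverse (real (Suc n))\<close> about any point of
    \<open>K n\<close> fits into \<open>S\<close>; this radius is the \<open>\<rho>\<close> of the
    step bound.\<close>
  define K where "K n = {y. inverse (real (Suc n)) \<le> infdist y (- S)}" for n
  have K_ball: "ball y (inverse (real (Suc n))) \<subseteq> S" if "y \<in> K n" for y n
    using that infdist_ge_imp_ball_subset by (auto simp: K_def)
  have K_S: "K n \<subseteq> S" for n using K_ball[of _ n] by (force simp: subset_iff)
  have K_closed: "closed (K n)" for n
    unfolding K_def by (intro closed_Collect_le continuous_intros)
  have exS: "AE \<omega> in M. \<exists>t\<ge>0. Z \<omega> t \<notin> S"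
    using AE_exits_disk by eventually_elim (use S1 in blast)
  \<comment> \<open>The index \<open>n\<close> fixes both the distance to the complement and the
    time horizon \<open>real (Suc n)\<close>; \<open>N\<close> refines the mesh. The limit in
    \<open>N\<close> is taken first, for fixed \<open>n\<close>.\<close>
  define X where "X n N \<omega> = f (Z \<omega> (real (stop_idx (\<lambda>i. Z \<omega> (real i * (real (Suc n) / real (Suc N))) \<in> K n) (Suc N))
      * (real (Suc n) / real (Suc N))))" for n N \<omega>
  define s where "s n \<omega> = min (Inf {t. 0 \<le> t \<and> Z \<omega> t \<notin> K n}) (real (Suc n))" for n \<omega>
  \<comment> \<open>Defined through \<open>lim\<close> so that it is measurable whatever the exit
    times are; for \<open>0 \<in> K n\<close> it equals \<open>f (Z \<omega> (s n \<omega>))\<close>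
    on every path that leaves \<open>S\<close>.\<close>
  define Y where "Y n \<omega> = lim (\<lambda>N. X n N \<omega>)" for n \<omega>
  have K_step:
      "X n N \<in> borel_measurable M"
      "\<bar>(\<integral>\<omega>. X n N \<omega> \<partial>M) - f 0\<bar> \<le> real (Suc N) * (4 * C * exp (- (inverse (real (Suc n)))\<^sup>2 / (4 * (real (Suc n) / real (Suc N)))))" for n N
  proof -
    have 1: "real (Suc n) / real (Suc N) > 0" "inverse (real (Suc n)) > 0" by simp_all
    have 2: "K n \<in> sets borel" using K_closed by (rule borel_closed)
    have 3: "F holomorphic_on ball z (inverse (real (Suc n)))" if "z \<in> K n" for z
      using F K_ball[OF that] by (rule holomorphic_on_subset)
    have 4: "f y = Re (F y)" if "z \<in> K n" "y \<in> ball z (inverse (real (Suc n)))" for y z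
      using K_ball[OF that(1)] that(2) by (auto simp: f_def)
    show "X n N \<in> borel_measurable M"
      "\<bar>(\<integral>\<omega>. X n N \<omega> \<partial>M) - f 0\<bar> \<le> real (Suc N) * (4 * C * exp (- (inverse (real (Suc n)))\<^sup>2 / (4 * (real (Suc n) / real (Suc N)))))"
      unfolding X_def[abs_def] by (rule stopped_expectation_bound[OF 1 2 f_meas f_bd 3 4]; assumption)+
  qed
  have [measurable]: "X n N \<in> borel_measurable M" for n N by fact
  have [measurable]: "Y n \<in> borel_measurable M" for n
    unfolding Y_def[abs_def] by (rule borel_measurable_lim_metric) simp
  have X_lim: "(\<lambda>N. X n N \<omega>) \<longlonglongrightarrow> f (Z \<omega> (s n \<omega>))"
    if w: "\<omega> \<in> space M" "\<exists>t\<ge>0. Z \<omega> t \<notin> S" "0 \<in> K n" for n \<omega>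
  proof -
    have exK: "\<exists>t\<ge>0. Z \<omega> t \<notin> K n" using w K_S by blast
    have z0: "Z \<omega> 0 \<in> K n" using w Z_0 by simp
    let ?p = "\<lambda>N. real (stop_idx (\<lambda>i. Z \<omega> (real i * (real (Suc n) / real N)) \<in> K n) N) * (real (Suc n) / real N)"
    have "?p \<longlonglongrightarrow> s n \<omega>"
      unfolding s_def by (rule grid_exit_tendsto[OF continuous_Z[OF w(1)] K_closed z0 exK]) simp
    then have p: "(\<lambda>N. ?p (Suc N)) \<longlonglongrightarrow> s n \<omega>" by (rule LIMSEQ_Suc)
    have "Z \<omega> (s n \<omega>) \<in> K n"
      unfolding s_def by (rule exit_time_in_closed[OF continuous_Z[OF w(1)] K_closed z0 exK]) simp
    then have c: "isCont f (Z \<omega> (s n \<omega>))" using f_cont K_S by blast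
    have s0: "s n \<omega> \<ge> 0" unfolding s_def using exK by (auto intro!: cInf_greatest)
    have "(\<lambda>N. Z \<omega> (?p (Suc N))) \<longlonglongrightarrow> Z \<omega> (s n \<omega>)"
      using s0 by (intro continuous_on_tendsto_compose[OF continuous_Z[OF w(1)] p]) auto
    then show ?thesis unfolding X_def by (rule isCont_tendsto_compose[OF c])
  qed
  have X_bd: "\<bar>X n N \<omega>\<bar> \<le> C" for n N \<omega> by (simp add: X_def f_bd del: stop_idx.simps)
  have EY: "(\<integral>\<omega>. Y n \<omega> \<partial>M) = f 0" if K0: "0 \<in> K n" for n
  proof (rule LIMSEQ_unique)
    show "(\<lambda>N. \<integral>\<omega>. X n N \<omega> \<partial>M) \<longlonglongrightarrow> (\<integral>\<omega>. Y n \<omega> \<partial>M)"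
    proof (rule integral_dominated_convergence[where w="\<lambda>_. C"])
      show "AE \<omega> in M. (\<lambda>N. X n N \<omega>) \<longlonglongrightarrow> Y n \<omega>"
        using exS AE_space
      proof eventually_elim
        case (elim \<omega>)
        then show ?case using X_lim[OF elim(2,1) K0] unfolding Y_def by (simp add: limI)
      qed
    qed (simp_all add: X_bd)
    have "(\<lambda>N. (\<integral>\<omega>. X n N \<omega> \<partial>M) - f 0) \<longlonglongrightarrow> 0"
    proof (rule Lim_null_comparison)
      \<comment> \<open>The mesh is inversely proportional to \<open>Suc N\<close>, so the exponent
        is linear in \<open>Suc N\<close> with rate \<open>c\<close> and outweighs the number of
        steps.\<close>
      define c where "c = (inverse (real (Suc n)))\<^sup>2 / (4 * real (Suc n))"
      have "c > 0" by (simp add: c_def)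
      have e: "- (inverse (real (Suc n)))\<^sup>2 / (4 * (real (Suc n) / real (Suc N))) = - (c * real (Suc N))" for N
        by (simp add: c_def)
      show "\<forall>\<^sub>F N in sequentially. norm ((\<integral>\<omega>. X n N \<omega> \<partial>M) - f 0) \<le> real (Suc N) * (4 * C * exp (- (c * real (Suc N))))"
        using K_step(2)[of n] unfolding e real_norm_def by (intro always_eventually allI)
      show "(\<lambda>N. real (Suc N) * (4 * C * exp (- (c * real (Suc N))))) \<longlonglongrightarrow> 0"
        using LIMSEQ_Suc[OF exponential_beats_linear[OF \<open>c > 0\<close>]] .
    qed
    then show "(\<lambda>N. \<integral>\<omega>. X n N \<omega> \<partial>M) \<longlonglongrightarrow> f 0" by (simp add: LIM_zero_iff)
  qed
  have K0: "\<forall>\<^sub>F n in sequentially. 0 \<in> K n"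
  proof -
    have "(2 :: complex) \<in> - S" using S1 by auto
    then have ne: "- S \<noteq> {}" by blast
    have "infdist 0 (- S) > 0"
      using S S0 ne in_closed_iff_infdist_zero[of "- S" 0] infdist_nonneg[of 0 "- S"] by (auto simp: less_le)
    with LIMSEQ_inverse_real_of_nat have "\<forall>\<^sub>F n in sequentially. inverse (real (Suc n)) < infdist 0 (- S)"
      by (rule order_tendstoD)
    then show ?thesis by eventually_elim (simp add: K_def)
  qed
  define g' where "g' \<omega> = lim (\<lambda>n. Y n \<omega>)" for \<omega>
  have [measurable]: "g' \<in> borel_measurable M"
    unfolding g'_def[abs_def] by (rule borel_measurable_lim_metric) simp
  have Y_lim: "AE \<omega> in M. (\<lambda>n. Y n \<omega>) \<longlonglongrightarrow> g \<omega>"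
    using exS lim AE_space
    proof eventually_elim
      case (elim \<omega>)
      have "filterlim (\<lambda>n. s n \<omega>) (at_left (Inf {t. 0 \<le> t \<and> Z \<omega> t \<notin> S})) sequentially"
        unfolding s_def K_def using elim S0 Z_0[of \<omega>]
        by (intro exit_times_exhaust continuous_Z S) auto
      with elim(2) have "(\<lambda>n. Re (F (Z \<omega> (s n \<omega>)))) \<longlonglongrightarrow> g \<omega>"
        by (rule filterlim_compose)
      moreover have "\<forall>\<^sub>F n in sequentially. Re (F (Z \<omega> (s n \<omega>))) = Y n \<omega>"
        using K0
      proof eventually_elim
        case (elim n)
        have w: "\<omega> \<in> space M" "\<exists>t\<ge>0. Z \<omega> t \<notin> S" by fact+
        have exK: "\<exists>t\<ge>0. Z \<omega> t \<notin> K n" using w(2) K_S by blast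
        have z0: "Z \<omega> 0 \<in> K n" using w Z_0 elim by simp
        have "Z \<omega> (s n \<omega>) \<in> K n"
          unfolding s_def by (rule exit_time_in_closed[OF continuous_Z[OF w(1)] K_closed z0 exK]) simp
        moreover have "Y n \<omega> = f (Z \<omega> (s n \<omega>))"
          unfolding Y_def using X_lim[OF w elim] by (rule limI)
        ultimately show ?case using K_S by (auto simp: f_def indicator_def)
      qed
      ultimately show ?case by (rule Lim_transform_eventually)
    qed
  have g': "AE \<omega> in M. g' \<omega> = g \<omega>"
    using Y_lim by eventually_elim (simp add: g'_def limI)
  have "(\<lambda>n. \<integral>\<omega>. Y n \<omega> \<partial>M) \<longlonglongrightarrow> (\<integral>\<omega>. g' \<omega> \<partial>M)"
  proof (rule integral_dominated_convergence[where w="\<lambda>_. C"])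
    show "AE \<omega> in M. (\<lambda>n. Y n \<omega>) \<longlonglongrightarrow> g' \<omega>"
      using Y_lim g' by eventually_elim simp
    show "AE \<omega> in M. norm (Y n \<omega>) \<le> C" for n
      using exS AE_space
    proof eventually_elim
      case (elim \<omega>)
      show ?case
      proof (cases "0 \<in> K n")
        case True
        then have "Y n \<omega> = f (Z \<omega> (s n \<omega>))"
          unfolding Y_def using X_lim[OF elim(2,1)] by (intro limI)
        then show ?thesis by (simp add: f_bd)
      next
        case False
        \<comment> \<open>Dominated convergence asks for the bound at every \<open>n\<close>; if
          \<open>0\<close> is not in \<open>K n\<close>, the sampled path is stopped at index 0 and
          the sequence is constant.\<close>
        have "X n N \<omega> = f (Z \<omega> 0)" for N
        proof -
          have "\<not> 0 < stop_idx (\<lambda>i. Z \<omega> (real i * (real (Suc n) / real (Suc N))) \<in> K n) (Suc N)"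
            using stop_idx_alive[of 0 "\<lambda>i. Z \<omega> (real i * (real (Suc n) / real (Suc N))) \<in> K n" "Suc N"] False Z_0[OF elim(2)]
            by (auto simp del: stop_idx.simps of_nat_Suc)
          then show ?thesis by (simp add: X_def del: stop_idx.simps)
        qed
        then show ?thesis by (simp add: Y_def f_bd)
      qed
    qed
  qed auto
  moreover have "(\<lambda>n. \<integral>\<omega>. Y n \<omega> \<partial>M) \<longlonglongrightarrow> f 0"
    using K0 by (intro tendsto_eventually) (auto elim!: eventually_mono simp: EY)
  ultimately have "(\<integral>\<omega>. g' \<omega> \<partial>M) = f 0" by (rule LIMSEQ_unique)
  then show thesis using S0 g' by (intro that[of g']) (simp_all add: f_def)
qed

end

section \<open>Harmonic measure of a radial slit\<close>

text \<open>\<open>Arcsin\<close> jumps across \<open>[1, \<infinity>)\<close>, but only in its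
  imaginary part. Its real part is the argument of
  \<open>w = \<i> * q + csqrt (1 - q\<^sup>2)\<close>. The root may switch sign, yet it approaches
  the imaginary axis with modulus tending to \<open>sqrt (q0\<^sup>2 - 1) < q0\<close>, so
  \<open>w\<close> approaches the positive imaginary axis and stays away from 0.\<close>

lemma tendsto_Re_Arcsin_slit:
  assumes q: "(q \<longlongrightarrow> of_real q0) A" and q0: "q0 \<ge> 1"
  shows "((\<lambda>x. Re (Arcsin (q x))) \<longlongrightarrow> pi / 2) A"
proof -
  define s where "s x = csqrt (1 - (q x)\<^sup>2)" for x
  define w where "w x = \<i> * q x + s x" for x
  have v: "((\<lambda>x. 1 - (q x)\<^sup>2) \<longlongrightarrow> of_real (1 - q0\<^sup>2)) A"
    using tendsto_diff[OF tendsto_const tendsto_power[OF q]] by simp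
  have q02: "q0\<^sup>2 \<ge> 1" using q0 by simp
  have nq: "cmod (complex_of_real (1 - q0\<^sup>2)) = q0\<^sup>2 - 1"
    unfolding norm_of_real using q02 by linarith
  have ns: "((\<lambda>x. cmod (s x)) \<longlongrightarrow> sqrt (q0\<^sup>2 - 1)) A"
  proof -
    have "((\<lambda>x. sqrt (cmod (1 - (q x)\<^sup>2))) \<longlongrightarrow> sqrt (cmod (of_real (1 - q0\<^sup>2)))) A"
      by (intro tendsto_intros v)
    then show ?thesis unfolding nq s_def norm_csqrt .
  qed
  have "((\<lambda>x. sqrt ((cmod (1 - (q x)\<^sup>2) + Re (1 - (q x)\<^sup>2)) / 2)) \<longlongrightarrow>
      sqrt ((cmod (of_real (1 - q0\<^sup>2)) + Re (of_real (1 - q0\<^sup>2))) / 2)) A"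
    by (intro tendsto_intros v) auto
  then have Res: "((\<lambda>x. Re (s x)) \<longlongrightarrow> 0) A"
    unfolding nq s_def csqrt.sel Re_complex_of_real by simp
  have Rew: "((\<lambda>x. Re (w x)) \<longlongrightarrow> 0) A"
    unfolding w_def using tendsto_add[OF tendsto_minus[OF tendsto_Im[OF q]] Res] by simp
  \<comment> \<open>Half of the limiting lower bound for \<open>Im (w x)\<close> in the worse case,
    where the root points downwards.\<close>
  define m where "m = (q0 - sqrt (q0\<^sup>2 - 1)) / 2"
  have "sqrt (q0\<^sup>2 - 1) < q0" using q0 by (simp add: real_sqrt_less_iff real_less_lsqrt)
  then have m: "m > 0" by (simp add: m_def)
  have "((\<lambda>x. Re (q x) - cmod (s x)) \<longlongrightarrow> q0 - sqrt (q0\<^sup>2 - 1)) A"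
    using tendsto_diff[OF tendsto_Re[OF q] ns] by simp
  then have "\<forall>\<^sub>F x in A. m < Re (q x) - cmod (s x)"
    by (rule order_tendstoD) (use m in \<open>simp add: m_def field_simps\<close>)
  then have Imw: "\<forall>\<^sub>F x in A. m < Im (w x)"
  proof eventually_elim
    case (elim x)
    then show ?case using abs_Im_le_cmod[of "s x"] by (simp add: w_def)
  qed
  have ratio: "((\<lambda>x. Re (w x) / Im (w x)) \<longlongrightarrow> 0) A"
  proof (rule Lim_null_comparison)
    show "\<forall>\<^sub>F x in A. norm (Re (w x) / Im (w x)) \<le> \<bar>Re (w x)\<bar> / m"
      using Imw
    proof eventually_elim
      case (elim x)
      then have "\<bar>Re (w x)\<bar> / Im (w x) \<le> \<bar>Re (w x)\<bar> / m" using m by (intro divide_left_mono) auto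
      then show ?case using elim m by (simp add: abs_divide)
    qed
    show "((\<lambda>x. \<bar>Re (w x)\<bar> / m) \<longlongrightarrow> 0) A"
      using tendsto_divide[OF tendsto_rabs[OF Rew] tendsto_const[of m]] m by simp
  qed
  have "((\<lambda>x. pi / 2 - arctan (Re (w x) / Im (w x))) \<longlongrightarrow> pi / 2 - arctan 0) A"
    by (intro tendsto_intros ratio)
  moreover have "\<forall>\<^sub>F x in A. pi / 2 - arctan (Re (w x) / Im (w x)) = Re (Arcsin (q x))"
    using Imw
  proof eventually_elim
    case (elim x)
    then have I: "Im (w x) > 0" using m by linarith
    \<comment> \<open>Turning \<open>w\<close> by a quarter brings it into the right half-plane,
      where the argument is an \<open>arctan\<close>.\<close>
    define y where "y = - \<i> * w x"
    have y: "Re y = Im (w x)" "Im y = - Re (w x)" "y \<noteq> 0" "\<i> * y = w x"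
      using I by (auto simp: y_def complex_eq_iff)
    have "Ln (w x) = Ln y + \<i> * of_real pi / 2"
      using Ln_times_ii[OF y(3)] y I by (simp add: mult.commute)
    then have "Im (Ln (w x)) = pi / 2 + arctan (Im y / Re y)"
      using I y by (simp add: Im_Ln_eq)
    then have "Im (Ln (w x)) = pi / 2 - arctan (Re (w x) / Im (w x))"
      unfolding y by (simp add: arctan_minus)
    moreover have "Re (Arcsin (q x)) = Im (Ln (w x))" by (simp only: Re_Arcsin w_def s_def)
    ultimately show ?case by simp
  qed
  ultimately show ?thesis by (simp add: Lim_transform_eventually)
qed

text \<open>For imaginary \<open>q\<close> the number under the logarithm is a positive real, of
  argument 0.\<close>

lemma Re_Arcsin_imaginary: "Re q = 0 \<Longrightarrow> Re (Arcsin q) = 0"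
proof -
  assume q: "Re q = 0"
  define y where "y = Im q"
  have qy: "q = \<i> * of_real y" using q by (simp add: complex_eq_iff y_def)
  have "1 - q\<^sup>2 = of_real (1 + y\<^sup>2)" by (simp add: qy power_mult_distrib)
  then have "csqrt (1 - q\<^sup>2) = of_real (sqrt (1 + y\<^sup>2))"
    by (simp only: csqrt_of_real_nonneg Im_complex_of_real Re_complex_of_real) simp
  then have "\<i> * q + csqrt (1 - q\<^sup>2) = of_real (sqrt (1 + y\<^sup>2) - y)"
    by (simp add: qy complex_eq_iff)
  moreover have "sqrt (1 + y\<^sup>2) - y > 0"
    using real_sqrt_less_mono[of "y\<^sup>2" "1 + y\<^sup>2"] by simp
  ultimately show ?thesis by (simp only: Re_Arcsin Ln_of_real Im_complex_of_real)
qed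

text \<open>A whole ray in direction \<open>b\<close>, not a segment ending on the circle:
  membership of the star hull then means hitting this ray, for any set of times.\<close>

definition slit :: "complex \<Rightarrow> real \<Rightarrow> complex set" where
  "slit b r = {z. Im (cnj b * z) = 0 \<and> r \<le> Re (cnj b * z)}"

lemma closed_slit: "closed (slit b r)"
  unfolding slit_def by (intro closed_Collect_conj closed_Collect_eq closed_Collect_le continuous_intros)

text \<open>\<open>cayley\<close> maps the disk onto the right half-plane and the slit \<open>[r, 1)\<close> onto \<open>[1, \<infinity>)\<close>;
  \<open>Arcsin\<close> then straightens the slit half-plane to the strip \<open>0 < Re < \<pi>/2\<close>.\<close>
definition cayley :: "complex \<Rightarrow> real \<Rightarrow> complex \<Rightarrow> complex" where
  "cayley b r z = of_real ((1 - r) / (1 + r)) * ((1 + cnj b * z) / (1 - cnj b * z))"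

definition slit_measure :: "complex \<Rightarrow> real \<Rightarrow> complex \<Rightarrow> complex" where
  "slit_measure b r z = of_real (2 / pi) * Arcsin (cayley b r z)"

lemma cayley_Re_Im:
  "Re (cayley b r z) = (1 - r) / (1 + r) * (1 - (cmod (cnj b * z))\<^sup>2) / (cmod (1 - cnj b * z))\<^sup>2"
  "Im (cayley b r z) = (1 - r) / (1 + r) * (2 * Im (cnj b * z)) / (cmod (1 - cnj b * z))\<^sup>2"
proof -
  define y where "y = cnj b * z"
  define c where "c = (1 - r) / (1 + r)"
  have "(1 + y) / (1 - y) = (1 + y) * cnj (1 - y) / of_real ((cmod (1 - y))\<^sup>2)"
    by (subst complex_div_cnj) simp
  then have "cayley b r z = of_real (c / (cmod (1 - y))\<^sup>2) * ((1 + y) * cnj (1 - y))"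
    by (simp add: cayley_def y_def c_def)
  then have "Re (cayley b r z) = c / (cmod (1 - y))\<^sup>2 * Re ((1 + y) * cnj (1 - y))"
    "Im (cayley b r z) = c / (cmod (1 - y))\<^sup>2 * Im ((1 + y) * cnj (1 - y))"
    by (simp_all only: Re_complex_of_real Im_complex_of_real times_complex.sel mult_zero_left diff_zero add_0_right)
  moreover have "Re ((1 + y) * cnj (1 - y)) = 1 - (cmod y)\<^sup>2" "Im ((1 + y) * cnj (1 - y)) = 2 * Im y"
    unfolding cmod_power2 by (simp_all add: algebra_simps power2_eq_square)
  ultimately show "Re (cayley b r z) = (1 - r) / (1 + r) * (1 - (cmod (cnj b * z))\<^sup>2) / (cmod (1 - cnj b * z))\<^sup>2"
    "Im (cayley b r z) = (1 - r) / (1 + r) * (2 * Im (cnj b * z)) / (cmod (1 - cnj b * z))\<^sup>2"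
    by (simp_all add: c_def y_def)
qed

context
  fixes b :: complex and r :: real
  assumes b: "cmod b = 1" and r: "0 < r" "r < 1"
begin

lemma cnj_b_eq_1: "cnj b * z = 1 \<longleftrightarrow> z = b"
proof -
  have "b * cnj b = 1" using b complex_norm_square[of b] by simp
  then show ?thesis by (metis mult.assoc mult.commute mult_1)
qed

lemma cayley_real:
  assumes "Im (cnj b * z) = 0"
  shows "cayley b r z = of_real ((1 - r) / (1 + r) * ((1 + Re (cnj b * z)) / (1 - Re (cnj b * z))))"
proof -
  define t where "t = Re (cnj b * z)"
  have e: "cnj b * z = of_real t" using assms by (simp add: complex_eq_iff t_def)
  show ?thesis unfolding cayley_def e by simp
qed

text \<open>\<open>Arcsin\<close> is holomorphic away from the real numbers of modulus at least 1. A
  real value of \<open>cayley\<close> comes from a real \<open>y = cnj b * z\<close>; off the slit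
  \<open>y < r\<close>, which is exactly the condition that the value be below 1, and
  \<open>\<bar>y\<bar> < 1\<close> makes it nonnegative.\<close>

lemma slit_measure_holomorphic: "slit_measure b r holomorphic_on (ball 0 1 - slit b r)"
proof -
  have ne: "1 - cnj b * z \<noteq> 0" if "cmod z < 1" for z
    using that b cnj_b_eq_1[of z] by auto
  have "cayley b r holomorphic_on (ball 0 1 - slit b r)"
    unfolding cayley_def using ne by (intro holomorphic_intros) auto
  moreover have "Arcsin holomorphic_on (cayley b r ` (ball 0 1 - slit b r))"
  proof (rule holomorphic_on_Arcsin)
    fix q assume "q \<in> cayley b r ` (ball 0 1 - slit b r)" and q: "Im q = 0"
    then obtain z where z: "cmod z < 1" "z \<notin> slit b r" "q = cayley b r z" by auto
    define y where "y = Re (cnj b * z)"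
    have "Im (cnj b * z) = 0" using q r ne[OF z(1)] unfolding z(3) cayley_Re_Im by simp
    then have qy: "q = of_real ((1 - r) / (1 + r) * ((1 + y) / (1 - y)))" and "y < r"
      using cayley_real[of z] z by (auto simp: y_def slit_def)
    have "cmod (cnj b * z) < 1" using z b by (simp add: norm_mult)
    then have "\<bar>y\<bar> < 1" unfolding y_def using abs_Re_le_cmod[of "cnj b * z"] by linarith
    then have "(1 + y) * (1 - r) < (1 + r) * (1 - y)" "1 + y > 0" "1 - y > 0"
      using \<open>y < r\<close> by (auto simp: algebra_simps)
    then have "(1 - r) / (1 + r) * ((1 + y) / (1 - y)) < 1" "(1 - r) / (1 + r) * ((1 + y) / (1 - y)) \<ge> 0"
      using r by (simp_all add: mult.commute[of "1 - r"] divide_less_eq_1_pos)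
    then show "\<bar>Re q\<bar> < 1" by (simp only: qy Re_complex_of_real abs_of_nonneg)
  qed
  ultimately have "(Arcsin \<circ> cayley b r) holomorphic_on (ball 0 1 - slit b r)"
    by (rule holomorphic_on_compose)
  then show ?thesis unfolding slit_measure_def[abs_def] by (intro holomorphic_intros) (simp add: comp_def)
qed

text \<open>A crude bound from \<open>\<bar>Re (Arcsin q)\<bar> \<le> pi\<close>, serving as the
  constant in \<open>harmonic_exit_value\<close>.\<close>

lemma slit_measure_bound: "\<bar>Re (slit_measure b r z)\<bar> \<le> 2"
proof -
  have "\<bar>Re (slit_measure b r z)\<bar> = 2 / pi * \<bar>Re (Arcsin (cayley b r z))\<bar>"
    by (simp add: slit_measure_def abs_mult)
  also have "\<dots> \<le> 2 / pi * pi" by (intro mult_left_mono Re_Arcsin_bound) auto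
  finally show ?thesis by simp
qed

lemma slit_measure_0: "Re (slit_measure b r 0) = 2 / pi * arcsin ((1 - r) / (1 + r))"
proof -
  have "arcsin ((1 - r) / (1 + r)) = Re (Arcsin (of_real ((1 - r) / (1 + r))))"
    using r by (intro arcsin_eq_Re_Arcsin) (auto simp: field_simps)
  then show ?thesis by (simp add: slit_measure_def cayley_def)
qed

lemma tendsto_cayley:
  assumes "(f \<longlongrightarrow> z) A" "z \<noteq> b" shows "((\<lambda>x. cayley b r (f x)) \<longlongrightarrow> cayley b r z) A"
  unfolding cayley_def using assms(2) cnj_b_eq_1[of z] by (intro tendsto_intros assms(1)) auto

lemma slit_measure_tendsto_slit:
  assumes f: "(f \<longlongrightarrow> z) A" and z: "z \<in> slit b r" "cmod z < 1"
  shows "((\<lambda>x. Re (slit_measure b r (f x))) \<longlongrightarrow> 1) A"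
proof -
  define y where "y = Re (cnj b * z)"
  have "cmod (cnj b * z) < 1" using z b by (simp add: norm_mult)
  then have y: "r \<le> y" "y < 1" using z abs_Re_le_cmod[of "cnj b * z"] by (auto simp: y_def slit_def)
  have "(1 + r) * (1 - y) \<le> (1 - r) * (1 + y)" using y by (simp add: algebra_simps)
  then have "1 \<le> (1 - r) / (1 + r) * ((1 + y) / (1 - y))" using y r by (simp add: le_divide_eq_1_pos)
  moreover have "z \<noteq> b" using z b by auto
  moreover have "cayley b r z = of_real ((1 - r) / (1 + r) * ((1 + y) / (1 - y)))"
    using cayley_real[of z] z by (simp add: y_def slit_def)
  ultimately have "((\<lambda>x. Re (Arcsin (cayley b r (f x)))) \<longlongrightarrow> pi / 2) A"
    using tendsto_cayley[OF f] by (intro tendsto_Re_Arcsin_slit) auto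
  then have "((\<lambda>x. 2 / pi * Re (Arcsin (cayley b r (f x)))) \<longlongrightarrow> 2 / pi * (pi / 2)) A"
    by (rule tendsto_mult_left)
  then show ?thesis by (simp add: slit_measure_def)
qed

text \<open>On the circle without \<open>b\<close>, \<open>cayley\<close> is finite and imaginary;
  \<open>Arcsin\<close> is continuous there with real part 0.\<close>

lemma slit_measure_tendsto_circle:
  assumes f: "(f \<longlongrightarrow> z) A" and z: "cmod z = 1" "z \<noteq> b"
  shows "((\<lambda>x. Re (slit_measure b r (f x))) \<longlongrightarrow> 0) A"
proof -
  have 0: "Re (cayley b r z) = 0" using z b by (simp add: cayley_Re_Im norm_mult)
  then have "isCont Arcsin (cayley b r z)" by (intro isCont_Arcsin) auto
  then have "((\<lambda>x. Arcsin (cayley b r (f x))) \<longlongrightarrow> Arcsin (cayley b r z)) A"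
    using tendsto_cayley[OF f z(2)] by (rule isCont_tendsto_compose)
  then have "((\<lambda>x. Re (Arcsin (cayley b r (f x)))) \<longlongrightarrow> 0) A"
    using Re_Arcsin_imaginary[OF 0] tendsto_Re by fastforce
  then have "((\<lambda>x. 2 / pi * Re (Arcsin (cayley b r (f x)))) \<longlongrightarrow> 2 / pi * 0) A"
    by (rule tendsto_mult_left)
  then show ?thesis by (simp add: slit_measure_def)
qed

end

section \<open>Hitting probabilities of the slits\<close>

context planar_bm
begin

definition exit_time :: "'a \<Rightarrow> complex set \<Rightarrow> real" where
  "exit_time \<omega> S = Inf {t. 0 \<le> t \<and> Z \<omega> t \<notin> S}"

lemma disk_exit_time_eq: "disk_exit_time (W \<omega>) = exit_time \<omega> (ball 0 1)"
  by (simp add: disk_exit_time_def exit_time_def Z_def)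

lemma exit_timeD:
  assumes "\<omega> \<in> space M" "open S" "0 \<in> S" "\<exists>t\<ge>0. Z \<omega> t \<notin> S"
  shows "exit_time \<omega> S > 0" "Z \<omega> (exit_time \<omega> S) \<notin> S"
    "\<And>t. 0 \<le> t \<Longrightarrow> t < exit_time \<omega> S \<Longrightarrow> Z \<omega> t \<in> S"
    "\<And>t. 0 \<le> t \<Longrightarrow> Z \<omega> t \<notin> S \<Longrightarrow> exit_time \<omega> S \<le> t"
    "((\<lambda>t. Z \<omega> t) \<longlongrightarrow> Z \<omega> (exit_time \<omega> S)) (at_left (exit_time \<omega> S))"
  unfolding exit_time_def
  using continuous_exit_value[OF continuous_Z[OF assms(1)] assms(2) _ assms(4)] Z_0[OF assms(1)] assms(3)
  by simp_all

lemma norm_exit_le: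
  assumes "\<omega> \<in> space M" "open S" "0 \<in> S" "\<exists>t\<ge>0. Z \<omega> t \<notin> S" and S1: "S \<subseteq> ball 0 1"
  shows "cmod (Z \<omega> (exit_time \<omega> S)) \<le> 1"
proof -
  note E = exit_timeD[OF assms(1-4)]
  show ?thesis
  proof (rule tendsto_upperbound[OF tendsto_norm[OF E(5)]])
    show "\<forall>\<^sub>F t in at_left (exit_time \<omega> S). cmod (Z \<omega> t) \<le> 1"
      unfolding eventually_at_left_field using E(1,3) S1
      by (intro exI[of _ 0]) (auto simp: subset_iff less_imp_le)
  qed auto
qed

text \<open>The positive harmonic functions \<open>Re (\<epsilon> / (1 + \<epsilon> - cnj a * z))\<close> are \<open>1\<close> at \<open>a\<close> and at most \<open>\<epsilon>\<close> at \<open>0\<close>.\<close>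
lemma AE_exit_point_neq:
  assumes a: "cmod a = 1"
  shows "AE \<omega> in M. Z \<omega> (exit_time \<omega> (ball 0 1)) \<noteq> a"
proof -
  define F where "F e z = of_real e / (of_real (1 + e) - cnj a * z)" for e :: real and z
  have low: "Re (of_real (1 + e) - cnj a * z) \<ge> e" if "cmod z \<le> 1" for e z
  proof -
    have "Re (cnj a * z) \<le> cmod (cnj a * z)" by (rule complex_Re_le_cmod)
    also have "\<dots> \<le> 1" using that a by (simp add: norm_mult)
    finally show ?thesis by simp
  qed
  have ne: "of_real (1 + e) - cnj a * z \<noteq> 0" if "cmod z \<le> 1" "e > 0" for e z
    using low[OF that(1), of e] that(2) by (metis not_le zero_complex.sel(1))
  have F_pos: "Re (F e z) \<ge> 0" if "cmod z \<le> 1" "e > 0" for e z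
    unfolding F_def Re_divide_of_real using low[OF that(1), of e] that(2)
    by (simp add: Re_divide_of_real Re_divide zero_le_divide_iff)
  have F_le: "\<bar>Re (F e z)\<bar> \<le> 1" if "cmod z \<le> 1" "e > 0" for e z
  proof -
    have "e \<le> cmod (of_real (1 + e) - cnj a * z)"
      using low[OF that(1), of e] complex_Re_le_cmod by (rule order_trans)
    then have "cmod (F e z) \<le> 1" using that(2) by (simp add: F_def norm_divide divide_le_eq_1)
    then show ?thesis using abs_Re_le_cmod order_trans by blast
  qed
  have aa: "cnj a * a = 1" using a complex_norm_square[of a] by (simp add: mult.commute)
  let ?e = "\<lambda>m. inverse (real (Suc m))"
  let ?g = "\<lambda>m \<omega>. Re (F (?e m) (Z \<omega> (exit_time \<omega> (ball 0 1))))"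
  have ball_exit: "AE \<omega> in M. cmod (Z \<omega> (exit_time \<omega> (ball 0 1))) \<le> 1 \<and>
      ((\<lambda>t. Z \<omega> t) \<longlongrightarrow> Z \<omega> (exit_time \<omega> (ball 0 1))) (at_left (exit_time \<omega> (ball 0 1)))"
    using AE_exits_disk AE_space
  proof eventually_elim
    case (elim \<omega>)
    note e = exit_timeD[OF elim(2) open_ball _ elim(1)]
    have "cmod (Z \<omega> (exit_time \<omega> (ball 0 1))) \<le> 1"
      using elim by (intro norm_exit_le) auto
    then show ?case using e(5) by simp
  qed
  have "\<exists>g'. g' \<in> borel_measurable M \<and> (AE \<omega> in M. g' \<omega> = ?g m \<omega>) \<and> (\<integral>\<omega>. g' \<omega> \<partial>M) = Re (F (?e m) 0)" for m
  proof -
    have e: "?e m > 0" by simp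
    have "F (?e m) holomorphic_on ball 0 1"
      unfolding F_def using ne[OF _ e] by (intro holomorphic_intros) (simp del: of_nat_Suc)
    moreover have "AE \<omega> in M. ((\<lambda>s. Re (F (?e m) (Z \<omega> s))) \<longlongrightarrow> ?g m \<omega>) (at_left (Inf {t. 0 \<le> t \<and> Z \<omega> t \<notin> ball 0 1}))"
      using ball_exit unfolding exit_time_def[symmetric]
    proof eventually_elim
      case (elim \<omega>)
      then show ?case unfolding F_def using ne[OF _ e] by (intro tendsto_intros) auto
    qed
    ultimately show ?thesis
      using F_le[OF _ e] by (elim harmonic_exit_value[rotated 3, where C=1]) (auto simp del: of_nat_Suc)
  qed
  then obtain g' where g': "\<And>m. g' m \<in> borel_measurable M" "\<And>m. AE \<omega> in M. g' m \<omega> = ?g m \<omega>"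
    "\<And>m. (\<integral>\<omega>. g' m \<omega> \<partial>M) = Re (F (?e m) 0)" by metis
  note g'(1)[measurable]
  \<comment> \<open>The event of leaving at \<open>a\<close> need not be measurable.
    \<open>N\<close> is, and contains it up to a null set because every \<open>F (?e m)\<close>
    equals 1 at \<open>a\<close>; the means bound its probability by \<open>?e m\<close> for all
    \<open>m\<close>.\<close>
  define N where "N = {\<omega>\<in>space M. \<forall>m. g' m \<omega> = 1}"
  have [measurable]: "N \<in> sets M" unfolding N_def by measurable
  have "prob N \<le> ?e m" for m
  proof -
    have e: "?e m > 0" by simp
    have nonneg: "AE \<omega> in M. 0 \<le> g' m \<omega> \<and> g' m \<omega> \<le> 1"
      using g'(2)[of m] ball_exit
    proof eventually_elim
      case (elim \<omega>)
      then show ?case using F_pos[OF _ e] F_le[OF _ e] by (auto simp: abs_le_iff simp del: of_nat_Suc)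
    qed
    have "integrable M (g' m)"
      using nonneg by (intro integrable_const_bound[where B=1]) auto
    moreover have "integrable M (indicator N :: _ \<Rightarrow> real)" by (simp add: less_top[symmetric])
    ultimately have "(\<integral>\<omega>. indicator N \<omega> \<partial>M) \<le> (\<integral>\<omega>. g' m \<omega> \<partial>M)"
    proof (intro integral_mono_AE)
      show "AE \<omega> in M. indicator N \<omega> \<le> g' m \<omega>"
        using nonneg by eventually_elim (auto simp: N_def indicator_def)
    qed auto
    also have "\<dots> = Re (F (?e m) 0)" by (rule g'(3))
    also have "\<dots> = ?e m / (1 + ?e m)"
      unfolding F_def by (simp only: mult_zero_right diff_zero Re_complex_of_real of_real_divide[symmetric])
    also have "\<dots> \<le> ?e m / 1"
      by (rule divide_left_mono) (use e in \<open>simp_all del: of_nat_Suc inverse_positive_iff_positive add: add_pos_pos\<close>)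
    finally show ?thesis by simp
  qed
  then have "prob N \<le> 0"
    using LIMSEQ_inverse_real_of_nat by (intro LIMSEQ_le_const[of _ 0 "prob N"]) auto
  then have "emeasure M N = 0" by (simp add: emeasure_eq_measure measure_le_0_iff)
  then have "AE \<omega> in M. \<omega> \<notin> N" by (intro AE_not_in) (auto simp: null_sets_def)
  moreover have "AE \<omega> in M. \<forall>m. g' m \<omega> = ?g m \<omega>" using g'(2) by (simp add: AE_all_countable)
  ultimately show ?thesis
    using AE_space
  proof eventually_elim
    case (elim \<omega>)
    show ?case
    proof
      assume eq: "Z \<omega> (exit_time \<omega> (ball 0 1)) = a"
      have "F (?e m) a = 1" for m
        unfolding F_def aa by (simp del: of_nat_Suc)
      then have "\<forall>m. g' m \<omega> = 1" using elim(2) unfolding eq by simp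
      then show False using elim by (simp add: N_def)
    qed
  qed
qed

lemma star_hull_iff_slit:
  assumes x: "x \<noteq> 0"
  defines "b \<equiv> cplx x / of_real (norm x)"
  shows "x \<in> star_hull (W \<omega> ` A) \<longleftrightarrow> (\<exists>t\<in>A. Z \<omega> t \<in> slit b (norm x))"
proof
  have nx: "norm x > 0" using x by simp
  have cb: "cnj b * cplx x = of_real (norm x)"
  proof -
    have "cnj b * cplx x = cplx x * cnj (cplx x) / of_real (norm x)" by (simp add: b_def)
    also have "\<dots> = of_real ((norm x)\<^sup>2) / of_real (norm x)" by (simp only: complex_norm_square[symmetric] norm_cplx)
    also have "\<dots> = of_real (norm x)" using nx by (simp add: power2_eq_square)
    finally show ?thesis .
  qed
  have bb: "b * cnj b = 1"
    using x complex_norm_square[of b] by (simp add: b_def norm_divide)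
  {
    assume "x \<in> star_hull (W \<omega> ` A)"
    then obtain \<rho> t where h: "0 \<le> \<rho>" "\<rho> \<le> 1" "t \<in> A" "x = \<rho> *\<^sub>R W \<omega> t"
      unfolding star_hull_def by blast
    then have "\<rho> > 0" using x by (cases "\<rho> = 0") auto
    have "cplx x = of_real \<rho> * Z \<omega> t"
      using arg_cong[OF h(4), of cplx] by (simp add: cplx_scaleR Z_def)
    then have "of_real \<rho> * (cnj b * Z \<omega> t) = of_real (norm x)"
      using cb by (simp add: mult.left_commute)
    then have "cnj b * Z \<omega> t = of_real (norm x / \<rho>)" using \<open>\<rho> > 0\<close> by (simp add: field_simps)
    moreover have "norm x \<le> norm x / \<rho>"
      using \<open>\<rho> > 0\<close> mult_left_mono[OF h(2), of "norm x"] by (simp add: le_divide_eq)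
    ultimately have "Z \<omega> t \<in> slit b (norm x)" by (simp only: slit_def mem_Collect_eq Im_complex_of_real Re_complex_of_real)
    then show "\<exists>t\<in>A. Z \<omega> t \<in> slit b (norm x)" using h by blast
  }
  {
    assume "\<exists>t\<in>A. Z \<omega> t \<in> slit b (norm x)"
    then obtain t where t: "t \<in> A" "Im (cnj b * Z \<omega> t) = 0" "norm x \<le> Re (cnj b * Z \<omega> t)" by (auto simp: slit_def)
    define s where "s = Re (cnj b * Z \<omega> t)"
    have "s \<ge> norm x" using t(3) by (simp only: s_def)
    then have s: "s \<ge> norm x" "s > 0" using nx by linarith+
    have "cnj b * Z \<omega> t = of_real s" using t by (simp add: complex_eq_iff s_def)
    then have "(b * cnj b) * Z \<omega> t = b * of_real s" by (simp only: mult.assoc)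
    then have "Z \<omega> t = of_real (s / norm x) * cplx x" unfolding bb by (simp add: b_def)
    then have "cplx ((norm x / s) *\<^sub>R W \<omega> t) = cplx x"
      using s(2) nx by (simp add: cplx_scaleR Z_def)
    then have "x = (norm x / s) *\<^sub>R W \<omega> t" by (simp add: inj_cplx)
    moreover have "0 \<le> norm x / s" using norm_ge_zero s(2) by (rule divide_nonneg_pos)
    moreover have "norm x / s \<le> 1" using s(1) by (simp only: divide_le_eq_1_pos[OF s(2)])
    ultimately show "x \<in> star_hull (W \<omega> ` A)" unfolding star_hull_def using t(1) by blast
  }
qed

text \<open>\<open>H\<close> is any measurable version of the covering event. Its indicator is the
  boundary value of \<open>slit_measure\<close> at the exit from the slit disk, so its probability
  is the value at 0.\<close>

lemma prob_mem_star_hull: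
  assumes x: "0 < norm x" "norm x < 1"
    and meas: "H \<in> sets M"
    and H: "AE \<omega> in M. \<omega> \<in> H \<longleftrightarrow> x \<in> star_hull (W \<omega> ` {0..disk_exit_time (W \<omega>)})"
  shows "prob H = 2 / pi * arcsin ((1 - norm x) / (1 + norm x))"
proof -
  define r where "r = norm x"
  define b where "b = cplx x / of_real (norm x)"
  define S where "S = ball 0 1 - slit b r"
  have b: "cmod b = 1" using x by (simp add: b_def norm_divide)
  have r: "0 < r" "r < 1" using x by (auto simp: r_def)
  have S: "open S" "0 \<in> S" "S \<subseteq> ball 0 1"
    using r closed_slit[of b r] by (auto simp: S_def slit_def intro!: open_Diff)
  have "AE \<omega> in M. ((\<lambda>s. Re (slit_measure b r (Z \<omega> s))) \<longlongrightarrow> indicator H \<omega>) (at_left (Inf {t. 0 \<le> t \<and> Z \<omega> t \<notin> S}))"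
    using H AE_exits_disk AE_exit_point_neq[OF b] AE_space
  proof eventually_elim
    case (elim \<omega>)
    define T where "T = exit_time \<omega> S"
    define \<tau> where "\<tau> = exit_time \<omega> (ball 0 1)"
    have exS: "\<exists>t\<ge>0. Z \<omega> t \<notin> S" using elim(2) S(3) by blast
    note D = exit_timeD[OF elim(4) open_ball _ elim(2), folded \<tau>_def, simplified]
    note E = exit_timeD[OF elim(4) S(1,2) exS, folded T_def]
    have T\<tau>: "T \<le> \<tau>" using D(1,2) S(3) by (intro E(4)) auto
    have nT: "cmod (Z \<omega> T) \<le> 1"
      unfolding T_def using norm_exit_le[OF elim(4) S(1,2) exS S(3)] .
    have hull: "\<omega> \<in> H \<longleftrightarrow> (\<exists>t\<in>{0..\<tau>}. Z \<omega> t \<in> slit b r)"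
      unfolding elim(1) disk_exit_time_eq \<tau>_def[symmetric] b_def r_def
      using x by (intro star_hull_iff_slit) auto
    have T_eq: "T = \<tau>" if "cmod (Z \<omega> T) = 1"
      using D(4)[of T] E(1) T\<tau> that by auto
    show ?case
      unfolding exit_time_def[symmetric] T_def[symmetric]
    proof (cases "cmod (Z \<omega> T) < 1")
      case True
      then have sl: "Z \<omega> T \<in> slit b r" using E(2) by (auto simp: S_def)
      then have "\<omega> \<in> H" using hull T\<tau> E(1) by auto
      then show "((\<lambda>s. Re (slit_measure b r (Z \<omega> s))) \<longlongrightarrow> indicator H \<omega>) (at_left T)"
        using slit_measure_tendsto_slit[OF b r E(5) sl True] by simp
    next
      case False
      then have 1: "cmod (Z \<omega> T) = 1" using nT by simp
      then have nb: "Z \<omega> T \<noteq> b" using T_eq elim(3) by (simp add: \<tau>_def)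
      \<comment> \<open>An earlier hit of the slit would have ended the stay in \<open>S\<close>, so
        only \<open>t = T\<close> remains; there the path is on the circle, whose only slit point is
        \<open>b\<close>.\<close>
      have "Z \<omega> t \<notin> slit b r" if "t \<in> {0..\<tau>}" for t
      proof
        assume sl: "Z \<omega> t \<in> slit b r"
        have "T \<le> t" using that sl by (intro E(4)) (auto simp: S_def)
        then have "t = T" using T_eq[OF 1] that by auto
        define y where "y = cnj b * Z \<omega> t"
        have "cmod y = 1" using 1 b \<open>t = T\<close> by (simp add: y_def norm_mult)
        moreover have "Im y = 0" "Re y \<ge> r" using sl by (auto simp: slit_def y_def)
        ultimately have "y = 1" using r by (auto simp: complex_eq_iff cmod_def)
        then have "Z \<omega> t = b" using cnj_b_eq_1[OF b r] by (simp add: y_def)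
        then show False using nb \<open>t = T\<close> by simp
      qed
      then have "\<omega> \<notin> H" using hull by blast
      then show "((\<lambda>s. Re (slit_measure b r (Z \<omega> s))) \<longlongrightarrow> indicator H \<omega>) (at_left T)"
        using slit_measure_tendsto_circle[OF b r E(5) 1 nb] by simp
    qed
  qed
  then obtain g' where g': "g' \<in> borel_measurable M" "AE \<omega> in M. g' \<omega> = indicator H \<omega>"
    "(\<integral>\<omega>. g' \<omega> \<partial>M) = Re (slit_measure b r 0)"
    using harmonic_exit_value[OF S slit_measure_holomorphic[OF b r, folded S_def] slit_measure_bound[OF b r]] by blast
  have "prob H = (\<integral>\<omega>. indicator H \<omega> \<partial>M)" using meas by simp
  also have "\<dots> = (\<integral>\<omega>. g' \<omega> \<partial>M)"
    using g' meas by (intro integral_cong_AE) auto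
  finally show ?thesis using g'(3) slit_measure_0[OF b r] by (simp add: r_def)
qed

end

section \<open>The area integral\<close>

lemma emeasure_lborel_disk:
  assumes "r \<ge> 0" shows "emeasure lborel (ball (0 :: real \<times> real) r) = ennreal (pi * r\<^sup>2)"
  using assms by (simp add: emeasure_ball unit_ball_vol_2 power2_eq_square)

text \<open>Solving \<open>sin (pi * s / 2) < (1 - \<rho>) / (1 + \<rho>)\<close> for
  \<open>\<rho>\<close> gives the bound \<open>(1 - sin) / (1 + sin)\<close>, a squared tangent by
  the half-angle formulas, since \<open>sin (pi * s / 2) = cos (2 * \<psi>)\<close>.\<close>

lemma less_slit_probability_iff:
  fixes s \<rho> :: real
  assumes s: "0 < s" "s < 1" and \<rho>: "0 < \<rho>" "\<rho> < 1"
  shows "s < 2 / pi * arcsin ((1 - \<rho>) / (1 + \<rho>)) \<longleftrightarrow> \<rho> < (tan (pi / 4 - pi * s / 4))\<^sup>2"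
proof -
  define v where "v = (1 - \<rho>) / (1 + \<rho>)"
  define \<psi> where "\<psi> = pi / 4 - pi * s / 4"
  have ps: "0 < pi * s" "pi * s < pi" using s by auto
  have v: "0 < v" "v < 1" using \<rho> by (auto simp: v_def)
  have "s < 2 / pi * arcsin v \<longleftrightarrow> pi * s / 2 < arcsin v" by (auto simp: field_simps)
  also have "\<dots> \<longleftrightarrow> sin (pi * s / 2) < sin (arcsin v)"
    using ps arcsin_lbound[of v] arcsin_ubound[of v] v by (intro sin_mono_less_eq[symmetric]) auto
  also have "\<dots> \<longleftrightarrow> sin (pi * s / 2) < v" using v by (simp add: sin_arcsin)
  also have "\<dots> \<longleftrightarrow> \<rho> * (1 + sin (pi * s / 2)) < 1 - sin (pi * s / 2)"
    using \<rho> by (simp add: v_def less_divide_eq algebra_simps)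
  also have "sin (pi * s / 2) = cos (2 * \<psi>)"
  proof -
    have "2 * \<psi> = pi / 2 - pi * s / 2" by (simp add: \<psi>_def field_simps)
    then show ?thesis by (simp add: sin_cos_eq)
  qed
  also have "1 + cos (2 * \<psi>) = 2 * (cos \<psi>)\<^sup>2" by (simp add: cos_double_cos)
  also have "1 - cos (2 * \<psi>) = 2 * (sin \<psi>)\<^sup>2" by (simp add: cos_double_sin)
  also have "\<rho> * (2 * (cos \<psi>)\<^sup>2) < 2 * (sin \<psi>)\<^sup>2 \<longleftrightarrow> \<rho> < (tan \<psi>)\<^sup>2"
  proof -
    have "cos \<psi> > 0" unfolding \<psi>_def using ps pi_gt_zero by (intro cos_gt_zero_pi; linarith)
    then show ?thesis by (simp add: tan_def power_divide less_divide_eq)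
  qed
  finally show ?thesis by (simp add: v_def \<psi>_def)
qed

lemma slit_probability_le_1: "0 < \<rho> \<Longrightarrow> \<rho> < 1 \<Longrightarrow> 2 / pi * arcsin ((1 - \<rho>) / (1 + \<rho>)) \<le> 1"
  using arcsin_ubound[of "(1 - \<rho>) / (1 + \<rho>)"] by (simp add: field_simps)

lemma slit_probability_nonneg: "0 < \<rho> \<Longrightarrow> \<rho> < 1 \<Longrightarrow> 0 \<le> 2 / pi * arcsin ((1 - \<rho>) / (1 + \<rho>))"
proof -
  assume "0 < \<rho>" "\<rho> < 1"
  then have "arcsin 0 \<le> arcsin ((1 - \<rho>) / (1 + \<rho>))" by (subst arcsin_le_mono) auto
  then show ?thesis by simp
qed

lemma nn_integral_tan_power4:
  "(\<integral>\<^sup>+s. ennreal (pi * ((tan (pi / 4 - pi * s / 4))\<^sup>2)\<^sup>2) * indicator {0..1} s \<partial>lborel) = ennreal (pi - 8 / 3)"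
proof -
  define \<psi> where "\<psi> s = pi / 4 - pi * s / 4" for s :: real
  \<comment> \<open>An antiderivative of the fourth power of \<open>tan\<close> is
    \<open>tan ^ 3 / 3 - tan + id\<close>; the factor \<open>- 4\<close> turns the inner derivative
    \<open>- pi / 4\<close> into \<open>pi\<close>. The tangent is 1 at \<open>s = 0\<close> and 0
    at \<open>s = 1\<close>.\<close>
  define \<Phi> where "\<Phi> s = - 4 * ((tan (\<psi> s)) ^ 3 / 3 - tan (\<psi> s) + \<psi> s)" for s
  have psi: "cos (\<psi> s) \<noteq> 0" if "0 \<le> s" "s \<le> 1" for s
  proof -
    have "0 \<le> pi * s" "pi * s \<le> pi" using that by auto
    then have "cos (\<psi> s) > 0" unfolding \<psi>_def using pi_gt_zero by (intro cos_gt_zero_pi; linarith)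
    then show ?thesis by simp
  qed
  have "(\<integral>\<^sup>+s. ennreal (pi * ((tan (\<psi> s))\<^sup>2)\<^sup>2) * indicator {0..1} s \<partial>lborel) = ennreal (\<Phi> 1 - \<Phi> 0)"
  proof (rule nn_integral_FTC_Icc)
    show "(\<lambda>s. pi * ((tan (\<psi> s))\<^sup>2)\<^sup>2) \<in> borel_measurable borel"
      unfolding \<psi>_def tan_def by measurable
    fix s :: real assume "s \<in> {0..1}"
    then have s: "0 \<le> s" "s \<le> 1" by auto
    define t where "t = tan (\<psi> s)"
    have inv: "inverse ((cos (\<psi> s))\<^sup>2) = 1 + t\<^sup>2"
      using tan_sec[OF psi[OF s]] by (simp add: t_def power_inverse)
    have d1: "(\<psi> has_real_derivative (- pi / 4)) (at s)"
      unfolding \<psi>_def[abs_def] by (auto intro!: derivative_eq_intros)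
    define u where "u = (\<lambda>s. tan (\<psi> s))"
    have d2: "(u has_real_derivative (1 + t\<^sup>2) * (- pi / 4)) (at s)"
      using DERIV_chain2[OF DERIV_tan[OF psi[OF s]] d1] by (simp add: inv u_def)
    have "(\<Phi> has_real_derivative - 4 * ((3 * t\<^sup>2 * ((1 + t\<^sup>2) * (- pi / 4))) / 3 - (1 + t\<^sup>2) * (- pi / 4) + (- pi / 4)))
        (at s)"
    proof -
      have \<Phi>: "\<Phi> = (\<lambda>s. - 4 * (u s ^ 3 / 3 - u s + \<psi> s))" by (simp add: \<Phi>_def u_def fun_eq_iff)
      have "u s = t" by (simp add: u_def t_def)
      then show ?thesis unfolding \<Phi> by (auto intro!: derivative_eq_intros d1 d2)
    qed
    also have "- 4 * ((3 * t\<^sup>2 * ((1 + t\<^sup>2) * (- pi / 4))) / 3 - (1 + t\<^sup>2) * (- pi / 4) + (- pi / 4)) = pi * (t\<^sup>2)\<^sup>2"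
      by (simp add: field_simps power2_eq_square)
    finally show "(\<Phi> has_real_derivative pi * ((tan (\<psi> s))\<^sup>2)\<^sup>2) (at s)" by (simp add: t_def)
  qed auto
  also have "\<Phi> 1 - \<Phi> 0 = pi - 8 / 3"
    by (simp add: \<Phi>_def \<psi>_def tan_45)
  finally show ?thesis by (simp add: \<psi>_def)
qed

lemma nn_integral_slit_probability:
  defines "k \<equiv> \<lambda>x :: real \<times> real. if 0 < norm x \<and> norm x < 1
      then 2 / pi * arcsin ((1 - norm x) / (1 + norm x)) else 0"
  shows "(\<integral>\<^sup>+x. ennreal (k x) \<partial>lborel) = ennreal (pi - 8 / 3)"
proof -
  have [measurable]: "k \<in> borel_measurable borel"
  proof -
    \<comment> \<open>\<open>arcsin\<close> is continuous only on \<open>[-1, 1]\<close>; the clamp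
      makes it continuous everywhere and does not act on the arguments that occur in
      \<open>k\<close>.\<close>
    have "(\<lambda>r::real. arcsin (max (-1) (min 1 r))) \<in> borel_measurable borel"
      by (intro borel_measurable_continuous_onI continuous_intros) auto
    then have m[measurable]: "(\<lambda>x::real \<times> real. if 0 < norm x \<and> norm x < 1
      then 2 / pi * arcsin (max (-1) (min 1 ((1 - norm x) / (1 + norm x)))) else 0) \<in> borel_measurable borel"
      by measurable
    have "k = (\<lambda>x. if 0 < norm x \<and> norm x < 1
      then 2 / pi * arcsin (max (-1) (min 1 ((1 - norm x) / (1 + norm x)))) else 0)"
    proof
      fix x :: "real \<times> real"
      have "max (-1) (min 1 ((1 - norm x) / (1 + norm x))) = (1 - norm x) / (1 + norm x)" if "0 < norm x" "norm x < 1"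
      proof -
        have "(1 - norm x) / (1 + norm x) \<ge> 0" "(1 - norm x) / (1 + norm x) \<le> 1"
          using that by (auto simp: divide_le_eq_1 intro!: divide_nonneg_nonneg add_pos_nonneg)
        then show ?thesis by simp
      qed
      then show "k x = (if 0 < norm x \<and> norm x < 1
        then 2 / pi * arcsin (max (-1) (min 1 ((1 - norm x) / (1 + norm x)))) else 0)" by (simp add: k_def)
    qed
    then show ?thesis using m by simp
  qed
  have k0: "k x \<ge> 0" for x using slit_probability_nonneg by (simp add: k_def)
  have "(\<integral>\<^sup>+x. ennreal (k x) \<partial>lborel) = (\<integral>\<^sup>+x. (\<integral>\<^sup>+s. indicator {0<..<k x} s \<partial>lborel) \<partial>lborel)"
    using k0 by (simp add: emeasure_lborel_Ioo)
  also have "\<dots> = (\<integral>\<^sup>+x. (\<integral>\<^sup>+s. (if 0 < s \<and> s < k x then 1 else 0) \<partial>lborel) \<partial>lborel)"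
    by (intro nn_integral_cong) (auto simp: indicator_def)
  also have "\<dots> = (\<integral>\<^sup>+s. (\<integral>\<^sup>+x. (if 0 < s \<and> s < k x then 1 else 0) \<partial>lborel) \<partial>lborel)"
    by (rule lborel_pair.Fubini'[symmetric]) measurable
  also have "\<dots> = (\<integral>\<^sup>+s. ennreal (pi * ((tan (pi / 4 - pi * s / 4))\<^sup>2)\<^sup>2) * indicator {0..1} s \<partial>lborel)"
  proof (rule nn_integral_cong_AE)
    \<comment> \<open>At \<open>s = 0\<close> the two sides do differ: the left one is 0, the right
      one \<open>pi\<close>.\<close>
    have "AE s in lborel. s \<noteq> 0 \<and> s \<noteq> (1::real)" using AE_lborel_singleton by auto
    then show "AE s in lborel. (\<integral>\<^sup>+x. (if 0 < s \<and> s < k x then 1 else 0) \<partial>lborel)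
        = ennreal (pi * ((tan (pi / 4 - pi * s / 4))\<^sup>2)\<^sup>2) * indicator {0..1} s"
    proof eventually_elim
      case (elim s)
      show ?case
      proof (cases "0 < s \<and> s < 1")
        case False
        have "k x \<le> 1" for x using slit_probability_le_1 by (simp add: k_def)
        then have "\<not> (0 < s \<and> s < k x)" for x using False elim by (metis less_le_trans)
        then have "(if 0 < s \<and> s < k x then 1 else 0 :: ennreal) = 0" for x by (simp only: if_False)
        then show ?thesis using False elim by (simp only: nn_integral_const) (auto simp: indicator_def)
      next
        case True
        define R where "R = (tan (pi / 4 - pi * s / 4))\<^sup>2"
        have R: "0 \<le> R" by (simp add: R_def)
        have R1: "R \<le> 1"
        proof -
          have "0 < pi * s" "pi * s < pi" using True by auto
          then have "0 < pi / 4 - pi * s / 4" "pi / 4 - pi * s / 4 < pi / 4" by auto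
          then have "0 < tan (pi / 4 - pi * s / 4)" "tan (pi / 4 - pi * s / 4) < tan (pi / 4)"
            using pi_gt_zero by (intro tan_gt_zero tan_monotone; linarith)+
          then show ?thesis unfolding R_def by (simp add: tan_45 power_le_one)
        qed
        \<comment> \<open>The centre is missing because \<open>k 0 = 0\<close>;
          \<open>R \<le> 1\<close> keeps the ball away from points of norm at least 1, where
          \<open>k\<close> vanishes too.\<close>
        have eq: "(0 < s \<and> s < k x) \<longleftrightarrow> x \<in> ball 0 R - {0}" for x
        proof (cases "0 < norm x \<and> norm x < 1")
          case True
          then show ?thesis
            using less_slit_probability_iff[of s "norm x"] \<open>0 < s \<and> s < 1\<close> by (simp add: k_def R_def)
        next
          case False
          then show ?thesis using \<open>0 < s \<and> s < 1\<close> R1 by (auto simp: k_def)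
        qed
        have "(\<integral>\<^sup>+x. (if 0 < s \<and> s < k x then 1 else 0) \<partial>lborel) = (\<integral>\<^sup>+x. indicator (ball 0 R - {0 :: real \<times> real}) x \<partial>lborel)"
          unfolding eq by (intro nn_integral_cong) (auto simp: indicator_def)
        also have "\<dots> = emeasure lborel (ball 0 R - {0 :: real \<times> real})" by simp
        also have "\<dots> = emeasure lborel (ball (0 :: real \<times> real) R)"
          by (rule emeasure_Diff_null_set) auto
        also have "\<dots> = ennreal (pi * R\<^sup>2)" using R by (rule emeasure_lborel_disk)
        finally show ?thesis using True by (simp add: R_def)
      qed
    qed
  qed
  also have "\<dots> = ennreal (pi - 8 / 3)" by (rule nn_integral_tan_power4)
  finally show ?thesis .
qed

section \<open>Measurability of the hull and the expected area\<close>

lemma star_hull_image: "star_hull (w ` A) = (\<lambda>p. fst p *\<^sub>R w (snd p)) ` ({0..1} \<times> A)"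
proof (intro set_eqI iffI)
  fix x assume "x \<in> star_hull (w ` A)"
  then obtain \<rho> t where "0 \<le> \<rho>" "\<rho> \<le> 1" "t \<in> A" "x = \<rho> *\<^sub>R w t"
    unfolding star_hull_def by blast
  then show "x \<in> (\<lambda>p. fst p *\<^sub>R w (snd p)) ` ({0..1} \<times> A)" by (intro image_eqI[of _ _ "(\<rho>, t)"]) auto
next
  fix x assume "x \<in> (\<lambda>p. fst p *\<^sub>R w (snd p)) ` ({0..1} \<times> A)"
  then obtain \<rho> t where "0 \<le> \<rho>" "\<rho> \<le> 1" "t \<in> A" "x = \<rho> *\<^sub>R w t" by auto
  then show "x \<in> star_hull (w ` A)" unfolding star_hull_def by blast
qed

context planar_bm
begin

text \<open>Absolute values keep the rational times in the range where \<open>W\<close> is measurable and continuous.\<close>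
definition rational_before_exit :: "'a \<Rightarrow> rat \<Rightarrow> bool" where
  "rational_before_exit \<omega> q \<longleftrightarrow> (\<exists>m::nat. \<forall>s::rat. \<bar>s\<bar> < \<bar>q\<bar> \<longrightarrow>
     norm (W \<omega> \<bar>of_rat s\<bar>) \<le> 1 - inverse (real (Suc m)))"

text \<open>The hull as a closure of rational multiples of the path at rational times before the
  exit: only countably many operations on \<open>W\<close> at fixed times occur, which makes the
  graph jointly measurable.\<close>

definition hull_graph :: "('a \<times> real \<times> real) set" where
  "hull_graph = {p \<in> space (M \<Otimes>\<^sub>M lborel). \<forall>n::nat. \<exists>(q::rat) (\<rho>::rat). 0 \<le> \<rho> \<and> \<rho> \<le> 1 \<and>
     rational_before_exit (fst p) q \<and>
     norm (of_rat \<rho> *\<^sub>R W (fst p) \<bar>of_rat q\<bar> - snd p) < inverse (real (Suc n))}"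

lemma measurable_W_abs [measurable]: "(\<lambda>\<omega>. W \<omega> \<bar>t\<bar>) \<in> borel_measurable M"
  by (rule measurable_W) simp

lemma sets_hull_graph [measurable]: "hull_graph \<in> sets (M \<Otimes>\<^sub>M lborel)"
  unfolding hull_graph_def rational_before_exit_def by measurable

text \<open>If the exit came before \<open>\<bar>q\<bar>\<close>, continuity would give rational
  times just after it with norm arbitrarily close to 1 or larger, contradicting the uniform gap
  below 1.\<close>

lemma rational_before_exitD:
  assumes w: "\<omega> \<in> space M" and ex: "\<exists>t\<ge>0. Z \<omega> t \<notin> ball 0 1" and q: "rational_before_exit \<omega> q"
  shows "\<bar>of_rat q\<bar> \<le> disk_exit_time (W \<omega>)"
proof (rule ccontr)
  define T where "T = disk_exit_time (W \<omega>)"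
  note D = exit_timeD[OF w open_ball _ ex, folded disk_exit_time_eq T_def, simplified]
  obtain m :: nat where m: "\<And>s::rat. \<bar>s\<bar> < \<bar>q\<bar> \<Longrightarrow> norm (W \<omega> \<bar>of_rat s\<bar>) \<le> 1 - inverse (real (Suc m))"
    using q unfolding rational_before_exit_def by blast
  let ?e = "inverse (real (Suc m))"
  assume "\<not> \<bar>of_rat q\<bar> \<le> disk_exit_time (W \<omega>)"
  then have Tq: "T < \<bar>of_rat q\<bar>" by (simp add: T_def)
  obtain d where d: "d > 0" "\<And>y. y \<in> {0..} \<Longrightarrow> dist y T < d \<Longrightarrow> dist (W \<omega> y) (W \<omega> T) < ?e"
    using continuous_W[OF w] D(1) unfolding continuous_on_iff
    by (metis atLeast_iff inverse_positive_iff_positive less_imp_le of_nat_0_less_iff zero_less_Suc)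
  obtain s where s: "T < of_rat s" "of_rat s < min (T + d) \<bar>of_rat q\<bar>"
    using of_rat_dense[of T "min (T + d) \<bar>of_rat q\<bar>"] Tq d(1) by auto
  have s0: "\<bar>of_rat s\<bar> = (of_rat s :: real)" using s D(1) by linarith
  then have "(of_rat \<bar>s\<bar> :: real) = of_rat s" by simp
  then have "(of_rat \<bar>s\<bar> :: real) < of_rat \<bar>q\<bar>" using s by simp
  then have "\<bar>s\<bar> < \<bar>q\<bar>" by (simp only: of_rat_less)
  then have "norm (W \<omega> (of_rat s)) \<le> 1 - ?e" using m[of s] unfolding s0 by blast
  moreover have "dist (W \<omega> (of_rat s)) (W \<omega> T) < ?e"
  proof -
    have "0 \<le> (of_rat s :: real)" using s D(1) by linarith
    moreover have "\<bar>of_rat s - T\<bar> < d" using s by linarith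
    ultimately show ?thesis using d(2)[of "of_rat s"] unfolding atLeast_iff dist_real_def by blast
  qed
  moreover have "norm (W \<omega> T) \<ge> 1" using D(2) by (simp add: Z_def)
  ultimately show False using norm_triangle_ineq2[of "W \<omega> T" "W \<omega> (of_rat s)"]
    by (simp add: dist_norm norm_minus_commute)
qed

text \<open>The gap comes from compactness: on \<open>[0, \<bar>q\<bar>]\<close> the norm attains
  its maximum, which is below 1. That equality of \<open>\<bar>q\<bar>\<close> with the exit time is
  left open does no harm, since the hull is closed.\<close>

lemma rational_before_exitI:
  assumes w: "\<omega> \<in> space M" and ex: "\<exists>t\<ge>0. Z \<omega> t \<notin> ball 0 1"
    and q: "\<bar>of_rat q\<bar> < disk_exit_time (W \<omega>)"
  shows "rational_before_exit \<omega> q"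
proof -
  define T where "T = disk_exit_time (W \<omega>)"
  note D = exit_timeD[OF w open_ball _ ex, folded disk_exit_time_eq T_def, simplified]
  have "compact ((\<lambda>t. norm (W \<omega> t)) ` {0..\<bar>of_rat q\<bar>})"
    by (intro compact_continuous_image continuous_intros continuous_on_subset[OF continuous_W[OF w]]) auto
  then obtain t where t: "t \<in> {0..\<bar>of_rat q\<bar>}" "\<And>s. s \<in> {0..\<bar>of_rat q\<bar>} \<Longrightarrow> norm (W \<omega> s) \<le> norm (W \<omega> t)"
    using compact_attains_sup[of "(\<lambda>t. norm (W \<omega> t)) ` {0..\<bar>of_rat q\<bar>}"] by auto
  have "norm (W \<omega> t) < 1" using D(3)[of t] t(1) q by (simp add: Z_def T_def)
  then obtain m where m: "inverse (real (Suc m)) < 1 - norm (W \<omega> t)"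
    using reals_Archimedean[of "1 - norm (W \<omega> t)"] by auto
  have "norm (W \<omega> \<bar>of_rat s\<bar>) \<le> 1 - inverse (real (Suc m))" if "\<bar>s\<bar> < \<bar>q\<bar>" for s :: rat
  proof -
    have "(of_rat \<bar>s\<bar> :: real) < of_rat \<bar>q\<bar>" using that by (simp only: of_rat_less)
    then have "norm (W \<omega> \<bar>of_rat s\<bar>) \<le> norm (W \<omega> t)" by (intro t(2)) auto
    then show ?thesis using m by linarith
  qed
  then show ?thesis unfolding rational_before_exit_def by blast
qed

lemma compact_star_hull:
  assumes w: "\<omega> \<in> space M"
  shows "compact (star_hull (W \<omega> ` {0..T}))"
  unfolding star_hull_image
proof (rule compact_continuous_image)
  have "continuous_on ({0..1} \<times> {0..T}) (\<lambda>p. W \<omega> (snd p))"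
    by (intro continuous_on_compose2[OF continuous_W[OF w]] continuous_intros) auto
  then show "continuous_on ({0..1} \<times> {0..T}) (\<lambda>p. fst p *\<^sub>R W \<omega> (snd p))"
    by (intro continuous_intros)
qed (intro compact_Times compact_Icc)

lemma hull_graph_iff:
  assumes w: "\<omega> \<in> space M" and ex: "\<exists>t\<ge>0. Z \<omega> t \<notin> ball 0 1"
  shows "(\<omega>, x) \<in> hull_graph \<longleftrightarrow> x \<in> star_hull (W \<omega> ` {0..disk_exit_time (W \<omega>)})"
proof
  define T where "T = disk_exit_time (W \<omega>)"
  note D = exit_timeD[OF w open_ball _ ex, folded disk_exit_time_eq T_def, simplified]
  {
    assume h: "(\<omega>, x) \<in> hull_graph"
    have "\<exists>y\<in>star_hull (W \<omega> ` {0..T}). dist y x < e" if e: "e > 0" for e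
    proof -
      obtain n where n: "inverse (real (Suc n)) < e" using reals_Archimedean[OF e] by auto
      have "\<forall>n::nat. \<exists>(q::rat) (\<rho>::rat). 0 \<le> \<rho> \<and> \<rho> \<le> 1 \<and> rational_before_exit \<omega> q \<and>
        norm (of_rat \<rho> *\<^sub>R W \<omega> \<bar>of_rat q\<bar> - x) < inverse (real (Suc n))"
        using h unfolding hull_graph_def mem_Collect_eq fst_conv snd_conv by (rule conjunct2)
      then obtain q \<rho> :: rat where q: "0 \<le> \<rho>" "\<rho> \<le> 1" "rational_before_exit \<omega> q"
        "norm (of_rat \<rho> *\<^sub>R W \<omega> \<bar>of_rat q\<bar> - x) < inverse (real (Suc n))"
        by blast
      have "\<bar>of_rat q\<bar> \<le> T" unfolding T_def using rational_before_exitD[OF w ex q(3)] .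
      moreover have "0 \<le> (of_rat \<rho> :: real)" "of_rat \<rho> \<le> (1 :: real)" using q by auto
      ultimately have "of_rat \<rho> *\<^sub>R W \<omega> \<bar>of_rat q\<bar> \<in> star_hull (W \<omega> ` {0..T})"
        unfolding star_hull_image by (intro image_eqI[of _ _ "(of_rat \<rho>, \<bar>of_rat q\<bar>)"]) auto
      then show ?thesis using q(4) n by (intro bexI) (auto simp: dist_norm)
    qed
    then show "x \<in> star_hull (W \<omega> ` {0..disk_exit_time (W \<omega>)})"
      using compact_imp_closed[OF compact_star_hull[OF w]] closed_approachable unfolding T_def by blast
  }
  {
    assume "x \<in> star_hull (W \<omega> ` {0..disk_exit_time (W \<omega>)})"
    then obtain \<rho> t where h: "0 \<le> \<rho>" "\<rho> \<le> 1" "0 \<le> t" "t \<le> T" "x = \<rho> *\<^sub>R W \<omega> t"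
      unfolding star_hull_image T_def by auto
    have "\<exists>(q::rat) (\<rho>::rat). 0 \<le> \<rho> \<and> \<rho> \<le> 1 \<and> rational_before_exit \<omega> q \<and>
      norm (of_rat \<rho> *\<^sub>R W \<omega> \<bar>of_rat q\<bar> - x) < inverse (real (Suc n))" for n
    proof -
      have "continuous_on ({0..1} \<times> {0..}) (\<lambda>p. W \<omega> (snd p))"
        by (intro continuous_on_compose2[OF continuous_W[OF w]] continuous_intros) auto
      then have "continuous_on ({0..1} \<times> {0..}) (\<lambda>p. fst p *\<^sub>R W \<omega> (snd p))"
        by (intro continuous_intros)
      moreover have "(\<rho>, t) \<in> {0..1} \<times> {0..}" "inverse (real (Suc n)) > 0" using h by auto
      ultimately obtain d where d: "d > 0" "\<And>p. p \<in> {0..1} \<times> {0..} \<Longrightarrow> dist p (\<rho>, t) < d \<Longrightarrow>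
          dist (fst p *\<^sub>R W \<omega> (snd p)) (fst (\<rho>, t) *\<^sub>R W \<omega> (snd (\<rho>, t))) < inverse (real (Suc n))"
        unfolding continuous_on_iff by meson
      obtain \<rho>' :: rat where \<rho>': "max 0 (\<rho> - d / 2) < of_rat \<rho>'" "of_rat \<rho>' < min 1 (\<rho> + d / 2)"
        using of_rat_dense[of "max 0 (\<rho> - d / 2)" "min 1 (\<rho> + d / 2)"] d(1) h by auto
      \<comment> \<open>The cap by \<open>T\<close> keeps \<open>q\<close> strictly before the exit
        even for \<open>t = T\<close>, which is approximated from below; \<open>T > 0\<close> leaves
        room for it.\<close>
      obtain q :: rat where q: "max 0 (t - d / 2) < of_rat q" "of_rat q < min T (t + d / 2)"
        using of_rat_dense[of "max 0 (t - d / 2)" "min T (t + d / 2)"] d(1) h D(1) by auto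
      have "dist (of_rat \<rho>', of_rat q) (\<rho>, t) \<le> dist (of_rat \<rho>') \<rho> + dist (of_rat q) t"
        unfolding dist_Pair_Pair by (rule sqrt_sum_squares_le_sum) auto
      also have "\<dots> < d" using \<rho>' q by (auto simp: dist_real_def abs_if)
      finally have "dist (of_rat \<rho>', of_rat q) (\<rho>, t) < d" .
      then have "norm (of_rat \<rho>' *\<^sub>R W \<omega> (of_rat q) - x) < inverse (real (Suc n))"
        using d(2)[of "(of_rat \<rho>', of_rat q)"] \<rho>' q h(5) by (simp add: dist_norm less_imp_le)
      moreover have "\<bar>of_rat q\<bar> = (of_rat q :: real)" using q by simp
      moreover have "rational_before_exit \<omega> q"
        using q by (intro rational_before_exitI[OF w ex]) (auto simp: T_def)
      moreover have "0 \<le> \<rho>'" "\<rho>' \<le> 1" using \<rho>' by (auto simp: less_imp_le)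
      ultimately show ?thesis by (intro exI[of _ q] exI[of _ \<rho>']) simp
    qed
    then show "(\<omega>, x) \<in> hull_graph" unfolding hull_graph_def using w by (simp add: space_pair_measure)
  }
qed

lemma star_hull_exit_subset_cball:
  assumes w: "\<omega> \<in> space M" and ex: "\<exists>t\<ge>0. Z \<omega> t \<notin> ball 0 1"
  shows "star_hull (W \<omega> ` {0..disk_exit_time (W \<omega>)}) \<subseteq> cball 0 1"
proof
  define T where "T = disk_exit_time (W \<omega>)"
  note D = exit_timeD[OF w open_ball _ ex, folded disk_exit_time_eq T_def, simplified]
  fix x assume "x \<in> star_hull (W \<omega> ` {0..disk_exit_time (W \<omega>)})"
  then obtain \<rho> t where h: "0 \<le> \<rho>" "\<rho> \<le> 1" "0 \<le> t" "t \<le> T" "x = \<rho> *\<^sub>R W \<omega> t"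
    unfolding star_hull_image T_def by auto
  have "cmod (Z \<omega> T) \<le> 1"
    unfolding T_def disk_exit_time_eq using w ex by (intro norm_exit_le) auto
  then have "norm (W \<omega> t) \<le> 1" using D(3)[of t] h by (cases "t = T") (auto simp: Z_def)
  then have "\<rho> * norm (W \<omega> t) \<le> 1" using h by (intro mult_le_one) auto
  then show "x \<in> cball 0 1" using h by simp
qed

theorem expected_area_star_hull:
  "(\<integral>\<^sup>+\<omega>. emeasure lebesgue (star_hull (W \<omega> ` {0..disk_exit_time (W \<omega>)})) \<partial>M) = ennreal (pi - 8 / 3)"
proof -
  interpret P: pair_sigma_finite M "lborel :: (real \<times> real) measure" ..
  define k where "k x = (if 0 < norm x \<and> norm x < 1
      then 2 / pi * arcsin ((1 - norm x) / (1 + norm x)) else 0)" for x :: "real \<times> real"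
  define H where "H x = {\<omega>\<in>space M. (\<omega>, x) \<in> hull_graph}" for x
  have H_meas[measurable]: "H x \<in> sets M" for x unfolding H_def by measurable
  have H_AE: "AE \<omega> in M. \<omega> \<in> H x \<longleftrightarrow> x \<in> star_hull (W \<omega> ` {0..disk_exit_time (W \<omega>)})" for x
    using AE_exits_disk AE_space by eventually_elim (simp add: H_def hull_graph_iff)
  have "(\<integral>\<^sup>+\<omega>. emeasure lebesgue (star_hull (W \<omega> ` {0..disk_exit_time (W \<omega>)})) \<partial>M)
      = (\<integral>\<^sup>+\<omega>. (\<integral>\<^sup>+x. indicator hull_graph (\<omega>, x) \<partial>lborel) \<partial>M)"
  proof (rule nn_integral_cong_AE)
    show "AE \<omega> in M. emeasure lebesgue (star_hull (W \<omega> ` {0..disk_exit_time (W \<omega>)}))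
        = (\<integral>\<^sup>+x. indicator hull_graph (\<omega>, x) \<partial>lborel)"
      using AE_exits_disk AE_space
    proof eventually_elim
      case (elim \<omega>)
      let ?S = "star_hull (W \<omega> ` {0..disk_exit_time (W \<omega>)})"
      have S: "?S \<in> sets borel"
        using compact_imp_closed[OF compact_star_hull[OF elim(2)]] by (rule borel_closed)
      have "(\<integral>\<^sup>+x. indicator hull_graph (\<omega>, x) \<partial>lborel) = (\<integral>\<^sup>+x. indicator ?S x \<partial>lborel)"
        by (intro nn_integral_cong) (simp add: indicator_def hull_graph_iff[OF elim(2,1)])
      then show ?case using S by simp
    qed
  qed
  \<comment> \<open>Tonelli is applied to the graph, whose sections are the hulls for almost every
    path.\<close>
  also have "\<dots> = (\<integral>\<^sup>+x. (\<integral>\<^sup>+\<omega>. indicator hull_graph (\<omega>, x) \<partial>M) \<partial>lborel)"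
    by (rule P.Fubini'[symmetric]) measurable
  also have "\<dots> = (\<integral>\<^sup>+x. emeasure M (H x) \<partial>lborel)"
  proof (rule nn_integral_cong)
    fix x :: "real \<times> real"
    have "(\<integral>\<^sup>+\<omega>. indicator hull_graph (\<omega>, x) \<partial>M) = (\<integral>\<^sup>+\<omega>. indicator (H x) \<omega> \<partial>M)"
      by (intro nn_integral_cong) (simp add: H_def indicator_def)
    then show "(\<integral>\<^sup>+\<omega>. indicator hull_graph (\<omega>, x) \<partial>M) = emeasure M (H x)" by simp
  qed
  also have "\<dots> = (\<integral>\<^sup>+x. ennreal (k x) \<partial>lborel)"
  proof (rule nn_integral_cong_AE)
    \<comment> \<open>The origin lies in every hull although \<open>k 0 = 0\<close>, and points of
      the circle are covered neither by the slit formula nor by the inclusion in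
      \<open>cball 0 1\<close>; both sets are null.\<close>
    have "sphere (0 :: real \<times> real) 1 \<in> null_sets lborel"
      using negligible_sphere[of "0 :: real \<times> real" 1]
      by (auto simp: null_sets_completion_iff negligible_iff_null_sets)
    then have "AE x in lborel. x \<notin> sphere (0 :: real \<times> real) 1" by (rule AE_not_in)
    moreover have "AE x in lborel. x \<noteq> (0 :: real \<times> real)" by (rule AE_lborel_singleton)
    ultimately show "AE x in lborel. emeasure M (H x) = ennreal (k x)"
    proof eventually_elim
      case (elim x)
      show ?case
      proof (cases "norm x < 1")
        case True
        then have "prob (H x) = k x"
          using prob_mem_star_hull[OF _ _ H_meas H_AE, of x] elim by (simp add: k_def)
        then show ?thesis by (simp add: emeasure_eq_measure)
      next
        case False
        then have "norm x > 1" using elim by simp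
        have "AE \<omega> in M. \<omega> \<notin> H x"
          using H_AE[of x] AE_exits_disk AE_space
        proof eventually_elim
          case (elim \<omega>)
          then show ?case using star_hull_exit_subset_cball[of \<omega>] \<open>norm x > 1\<close> by auto
        qed
        then have "emeasure M (H x) = 0" by (subst (asm) AE_iff_measurable[OF H_meas[of x]]) (auto simp: H_def)
        then show ?thesis using False by (simp add: k_def)
      qed
    qed
  qed
  also have "\<dots> = ennreal (pi - 8 / 3)"
    unfolding k_def by (rule nn_integral_slit_probability)
  finally show ?thesis .
qed

end

theorem theorem5p1:
  fixes M :: "'a measure" and W :: "'a \<Rightarrow> real \<Rightarrow> real \<times> real"
  assumes "planar_brownian_motion M W"
  shows "(\<integral>\<^sup>+ \<omega>. emeasure lebesgue (star_hull (W \<omega> ` {0..disk_exit_time (W \<omega>)})) \<partial>M)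
           = ennreal (pi - 8 / 3)"
proof -
  interpret planar_bm M W by standard fact
  show ?thesis by (rule expected_area_star_hull)
qed

end
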